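(* Let $H$ be a complex Hilbert space, let $I\subseteq[0,\infty)$ be an interval, let $K\subseteq B(H)^+$ be a convex set, let $s\in(0,1]$, and let $f:I\to\mathbb{R}$ be an operator $s$-convex function on $I$ for operators in $K$. Then for all positive operators $A,B\in K$ with spectra contained in $I$ the following inequalities hold in the operator order of $B(H)$: \[ 2^{s-1}f\left(\frac{A+B}{2}\right)\leq\int_0^1 f((1-t)A+tB)\,dt\leq\frac{f(A)+f(B)}{s+1}. \]
   Context: $B(H)$ is the algebra of bounded linear operators on $H$, and $B(H)^+$ is the set of all positive operators in $B(H)$. For selfadjoint $A,B\in B(H)$, the operator order $A\le B$ means $\langle Ax,x\rangle\le\langle Bx,x\rangle$ for every $x\in H$. For a selfadjoint $A$ and a continuous function $f$ on the spectrum $Sp(A)$, $f(A)$ is given by the continuous functional calculus. Definition. Let $I$ be an interval in $[0,\infty)$, $K$ a convex subset of $B(H)^+$, and $s\in(0,1]$ fixed. A continuous function $f:I\to\mathbb{R}$ is operator $s$-convex on $I$ for operators in $K$ if \[ f((1-\lambda)A+\lambda B)\le(1-\lambda)^s f(A)+\lambda^s f(B) \] in the operator order, for all $\lambda\in[0,1]$ and all $A,B\in K$ whose spectra are contained in $I$. The integral is that of the operator-valued function $t\mapsto f((1-t)A+tB)$ on $[0,1]$ with values in $B(H)$. *)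

theory Defs
  imports "HOL-Analysis.Analysis"
begin

section \<open>Complex Hilbert spaces\<close>

text \<open>
  The underlying real inner product is the real part of the complex one, so norm, metric and
  topology are the library's, and positive definiteness is inherited from \<^class>\<open>real_inner\<close>.
  The complex inner product is linear in its first argument.
\<close>

class complex_inner = real_inner +
  fixes scaleC :: "complex \<Rightarrow> 'a \<Rightarrow> 'a" (infixr "*\<^sub>C" 75)
    and cinner :: "'a \<Rightarrow> 'a \<Rightarrow> complex"
  assumes scaleC_add_right: "c *\<^sub>C (x + y) = c *\<^sub>C x + c *\<^sub>C y"
    and scaleC_add_left: "(c + d) *\<^sub>C x = c *\<^sub>C x + d *\<^sub>C x"
    and scaleC_scaleC: "c *\<^sub>C (d *\<^sub>C x) = (c * d) *\<^sub>C x"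
    and scaleR_scaleC: "r *\<^sub>R x = complex_of_real r *\<^sub>C x"
    and cinner_commute: "cinner x y = cnj (cinner y x)"
    and cinner_add_left: "cinner (x + y) z = cinner x z + cinner y z"
    and cinner_scaleC_left: "cinner (c *\<^sub>C x) y = c * cinner x y"
    and inner_eq_Re_cinner: "inner x y = Re (cinner x y)"

class chilbert_space = complex_inner + complete_space

instantiation complex :: chilbert_space
begin

definition scaleC_complex :: "complex \<Rightarrow> complex \<Rightarrow> complex"
  where "scaleC_complex c x = c * x"

definition cinner_complex :: "complex \<Rightarrow> complex \<Rightarrow> complex"
  where "cinner_complex x y = x * cnj y"

instance
  by standard
    (simp_all add: scaleC_complex_def cinner_complex_def algebra_simps scaleR_conv_of_real
      inner_complex_def)

end

lemma cinner_self_norm: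
  fixes x :: "'a::complex_inner"
  shows "cinner x x = complex_of_real ((norm x)\<^sup>2)"
proof -
  have "Im (cinner x x) = 0"
    using arg_cong[OF cinner_commute[of x x], of Im] by simp
  moreover have "Re (cinner x x) = (norm x)\<^sup>2"
    by (metis inner_eq_Re_cinner power2_norm_eq_inner)
  ultimately show ?thesis
    by (simp add: complex_eq_iff)
qed

lemma norm_scaleC:
  fixes x :: "'a::complex_inner"
  shows "norm (c *\<^sub>C x) = cmod c * norm x"
proof -
  have "cinner (c *\<^sub>C x) (c *\<^sub>C x) = c * cnj c * cinner x x"
    by (metis cinner_commute cinner_scaleC_left complex_cnj_mult mult.assoc mult.commute)
  then have "complex_of_real ((norm (c *\<^sub>C x))\<^sup>2) = complex_of_real ((cmod c * norm x)\<^sup>2)"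
    by (simp add: cinner_self_norm complex_norm_square[symmetric] power_mult_distrib
        del: of_real_power)
  then have "(norm (c *\<^sub>C x))\<^sup>2 = (cmod c * norm x)\<^sup>2"
    using of_real_eq_iff by blast
  then show ?thesis
    by (simp add: power2_eq_iff_nonneg)
qed

lemma bounded_linear_scaleC:
  "bounded_linear (\<lambda>x::'a::complex_inner. c *\<^sub>C x)"
proof (rule bounded_linear_intro[of _ "cmod c"])
  show "c *\<^sub>C (r *\<^sub>R x) = r *\<^sub>R (c *\<^sub>C x)" for r and x :: 'a
    by (simp add: scaleR_scaleC scaleC_scaleC mult.commute)
qed (simp_all add: scaleC_add_right norm_scaleC mult.commute)


section \<open>Bounded operators\<close>

text \<open>
  The algebra $B(H)$ is represented as the set of those bounded real-linear operators that are
  complex linear.  It is a norm-closed real subspace of the type of bounded real-linear operators,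
  with the same operator norm; hence the integral of a $B(H)$-valued function is the library's
  integral on the ambient type.
\<close>

definition bounded_ops :: "('a::complex_inner \<Rightarrow>\<^sub>L 'a) set"
  where "bounded_ops = {T. \<forall>c x. blinfun_apply T (c *\<^sub>C x) = c *\<^sub>C blinfun_apply T x}"

lift_definition scaleC_op :: "complex \<Rightarrow> ('a::complex_inner \<Rightarrow>\<^sub>L 'a) \<Rightarrow> ('a \<Rightarrow>\<^sub>L 'a)"
  is "\<lambda>c T x. c *\<^sub>C T x"
  by (rule bounded_linear_compose[OF bounded_linear_scaleC])

definition is_adjoint :: "('a::complex_inner \<Rightarrow>\<^sub>L 'a) \<Rightarrow> ('a \<Rightarrow>\<^sub>L 'a) \<Rightarrow> bool"
  where "is_adjoint S T \<longleftrightarrow>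
    (\<forall>x y. cinner (blinfun_apply T x) y = cinner x (blinfun_apply S y))"

definition selfadjoint :: "('a::complex_inner \<Rightarrow>\<^sub>L 'a) \<Rightarrow> bool"
  where "selfadjoint A \<longleftrightarrow> A \<in> bounded_ops \<and> is_adjoint A A"

text \<open>For selfadjoint \<open>A\<close> the numbers \<open>cinner (A x) x\<close> are real, which justifies taking real parts.\<close>

definition op_le :: "('a::complex_inner \<Rightarrow>\<^sub>L 'a) \<Rightarrow> ('a \<Rightarrow>\<^sub>L 'a) \<Rightarrow> bool" (infix "\<le>\<^sub>o\<^sub>p" 50)
  where "A \<le>\<^sub>o\<^sub>p B \<longleftrightarrow> selfadjoint A \<and> selfadjoint B \<and>
    (\<forall>x. Re (cinner (blinfun_apply A x) x) \<le> Re (cinner (blinfun_apply B x) x))"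

definition positive_ops :: "('a::complex_inner \<Rightarrow>\<^sub>L 'a) set"
  where "positive_ops = {A. 0 \<le>\<^sub>o\<^sub>p A}"

definition spectrum :: "('a::complex_inner \<Rightarrow>\<^sub>L 'a) \<Rightarrow> complex set"
  where "spectrum A = {z. \<not> (\<exists>S\<in>bounded_ops.
    S o\<^sub>L (A - scaleC_op z id_blinfun) = id_blinfun \<and>
    (A - scaleC_op z id_blinfun) o\<^sub>L S = id_blinfun)}"


section \<open>Continuous functional calculus\<close>

text \<open>
  The isometric unital $*$-homomorphism from the continuous complex functions on the spectrum of
  \<open>A\<close> to $B(H)$ that sends the identity function to \<open>A\<close>.  A continuous function on the spectrum
  is represented by any total function restricting to it.  The isometry property is expressed by
  upper bounds because the spectrum is empty when the space is trivial.
\<close>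

definition is_continuous_calculus ::
    "('a::complex_inner \<Rightarrow>\<^sub>L 'a) \<Rightarrow> ((complex \<Rightarrow> complex) \<Rightarrow> ('a \<Rightarrow>\<^sub>L 'a)) \<Rightarrow> bool"
  where "is_continuous_calculus A \<Phi> \<longleftrightarrow>
    (\<forall>g. continuous_on (spectrum A) g \<longrightarrow>
      \<Phi> g \<in> bounded_ops \<and>
      is_adjoint (\<Phi> (\<lambda>z. cnj (g z))) (\<Phi> g) \<and>
      (\<forall>M\<ge>0. norm (\<Phi> g) \<le> M \<longleftrightarrow> (\<forall>z\<in>spectrum A. cmod (g z) \<le> M))) \<and>
    (\<forall>g h. continuous_on (spectrum A) g \<longrightarrow> continuous_on (spectrum A) h \<longrightarrow>
      (\<forall>a b. \<Phi> (\<lambda>z. a * g z + b * h z) = scaleC_op a (\<Phi> g) + scaleC_op b (\<Phi> h)) \<and>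
      \<Phi> (\<lambda>z. g z * h z) = \<Phi> g o\<^sub>L \<Phi> h) \<and>
    \<Phi> (\<lambda>z. 1) = id_blinfun \<and>
    \<Phi> (\<lambda>z. z) = A"

text \<open>
  The operator \<open>f(A)\<close>, for selfadjoint \<open>A\<close> (whose spectrum is real) and real \<open>f\<close> continuous on it.
\<close>

definition cfc :: "(real \<Rightarrow> real) \<Rightarrow> ('a::complex_inner \<Rightarrow>\<^sub>L 'a) \<Rightarrow> ('a \<Rightarrow>\<^sub>L 'a)"
  where "cfc f A =
    (THE T. \<exists>\<Phi>. is_continuous_calculus A \<Phi> \<and> T = \<Phi> (\<lambda>z. complex_of_real (f (Re z))))"


section \<open>Operator s-convexity\<close>

definition operator_s_convex ::
    "real \<Rightarrow> real set \<Rightarrow> ('a::complex_inner \<Rightarrow>\<^sub>L 'a) set \<Rightarrow> (real \<Rightarrow> real) \<Rightarrow> bool"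
  where "operator_s_convex s I K f \<longleftrightarrow>
    continuous_on I f \<and>
    (\<forall>u\<in>{0..1}. \<forall>A\<in>K. \<forall>B\<in>K.
      spectrum A \<subseteq> complex_of_real ` I \<longrightarrow> spectrum B \<subseteq> complex_of_real ` I \<longrightarrow>
      cfc f ((1 - u) *\<^sub>R A + u *\<^sub>R B) \<le>\<^sub>o\<^sub>p
        (1 - u) powr s *\<^sub>R cfc f A + u powr s *\<^sub>R cfc f B)"

end

theory Submission
  imports Defs "HOL-Computational_Algebra.Fundamental_Theorem_Algebra"
begin

text \<open>
  Write \<open>T(t) = (1 - t) A + t B\<close>.  The order relation only sees the quadratic forms
  \<open>g(t) = \<langle>f(T(t)) x, x\<rangle>\<close>, and for fixed \<open>x\<close> both inequalities are scalar.  For the upper one,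
  \<open>s\<close>-convexity gives \<open>g(t) \<le> (1 - t)\<^sup>s g(0) + t\<^sup>s g(1)\<close>, and both weights integrate to
  \<open>1 / (s + 1)\<close>.  For the lower one, \<open>(A + B) / 2\<close> is the midpoint of \<open>T(t)\<close> and \<open>T(1 - t)\<close>, so
  \<open>g(1/2) \<le> 2 powr (- s) * (g(t) + g(1 - t))\<close>, and the two summands have the same integral.

  The analytic content is that \<open>t \<mapsto> f(T(t))\<close> is norm continuous, hence integrable, with selfadjoint
  values.  This rests on three facts.

  First, the calculus exists and is unique for selfadjoint \<open>A\<close>.  The key is the norm formula
  \<open>\<parallel>p(A)\<parallel> = sup |p|\<close> over the spectrum, for complex polynomials \<open>p\<close> (\<open>norm_op_poly_le_iff\<close>).  A point
  of the spectrum is an approximate eigenvalue (\<open>spectrum_selfadjoint_iff\<close>), which gives one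
  inequality.  Conversely, \<open>\<parallel>p(A)\<parallel>\<^sup>2\<close> is an approximate eigenvalue of \<open>p(A)\<^sup>* p(A)\<close>, which is again a
  polynomial of \<open>A\<close>; splitting it into linear factors produces a point of the spectrum at which
  \<open>|p|\<close> equals \<open>\<parallel>p(A)\<parallel>\<close>.  By the Weierstrass theorem every continuous \<open>g\<close> is a uniform limit of
  polynomials on the spectrum, and \<open>g(A)\<close> is the limit of the corresponding operators
  (\<open>continuous_calculus_exists\<close>, \<open>continuous_calculus_unique\<close>).

  Secondly, all \<open>T(t)\<close> have their spectra in one compact subset of \<open>I\<close>: that the spectrum of a
  selfadjoint operator lies in the disc with centre \<open>c\<close> and radius \<open>r\<close> means \<open>\<parallel>A - c\<parallel> \<le> r\<close>, a convex
  condition on \<open>A\<close> (\<open>spectrum_segment_subset_compact\<close>).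

  Thirdly, on that compact set \<open>f\<close> is a uniform limit of polynomials, so \<open>t \<mapsto> f(T(t))\<close> is a uniform
  limit of the continuous functions \<open>t \<mapsto> p(T(t))\<close> (\<open>continuous_on_cfc\<close>).
\<close>

section \<open>Operators on a complex inner product space\<close>

instance chilbert_space \<subseteq> banach ..

interpretation complex_vector: vector_space "scaleC :: complex \<Rightarrow> 'a \<Rightarrow> 'a::complex_inner"
proof
  show "1 *\<^sub>C x = x" for x :: 'a
    using scaleR_scaleC[of 1 x] by simp
qed (simp_all add: scaleC_add_right scaleC_add_left scaleC_scaleC)

lemma cinner_eq_complex_inner:
  "cinner x y = Complex (inner x y) (inner x (\<i> *\<^sub>C y))"
proof -
  have "cinner x (\<i> *\<^sub>C y) = cnj (\<i> * cinner y x)"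
    by (metis cinner_commute cinner_scaleC_left)
  also have "\<dots> = - \<i> * cinner x y"
    using cinner_commute[of x y] by simp
  finally show ?thesis
    by (simp add: inner_eq_Re_cinner complex_eq_iff)
qed

lemma inner_scaleC_left: "inner (c *\<^sub>C x) y = inner x (cnj c *\<^sub>C y)"
  by (metis cinner_commute cinner_scaleC_left complex_cnj_mult
      complex_cnj_cancel_iff inner_eq_Re_cinner)

lemma blinfun_apply_bounded_ops: "A \<in> bounded_ops \<Longrightarrow> A (c *\<^sub>C x) = c *\<^sub>C A x"
  by (simp add: bounded_ops_def)

text \<open>The imaginary part of \<open>\<langle>x, y\<rangle>\<close> is the real inner product of \<open>x\<close> and \<open>\<i> y\<close>, so for complex-linear
  operators adjoints can be computed with the real inner product.\<close>

lemma is_adjoint_iff_inner: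
  assumes "S \<in> bounded_ops"
  shows "is_adjoint S T \<longleftrightarrow> (\<forall>x y. inner (T x) y = inner x (S y))"
proof
  assume "is_adjoint S T"
  then show "\<forall>x y. inner (T x) y = inner x (S y)"
    by (simp add: is_adjoint_def inner_eq_Re_cinner)
next
  assume "\<forall>x y. inner (T x) y = inner x (S y)"
  then show "is_adjoint S T"
    by (simp add: is_adjoint_def cinner_eq_complex_inner blinfun_apply_bounded_ops[OF assms, symmetric])
qed

lemma is_adjointD: "is_adjoint S T \<Longrightarrow> inner (T x) y = inner x (S y)"
  by (simp add: is_adjoint_def inner_eq_Re_cinner)

lemma selfadjoint_iff_inner:
  "selfadjoint A \<longleftrightarrow> A \<in> bounded_ops \<and> (\<forall>x y. inner (A x) y = inner x (A y))"
  using is_adjoint_iff_inner[of A A] by (auto simp: selfadjoint_def)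

lemma norm_adjoint_le:
  assumes "is_adjoint S T"
  shows "norm S \<le> norm T"
proof (rule norm_blinfun_bound)
  fix y
  have "norm (S y) * norm (S y) = inner (T (S y)) y"
    by (simp add: is_adjointD[OF assms] power2_eq_square[symmetric] power2_norm_eq_inner)
  also have "\<dots> \<le> norm T * norm (S y) * norm y"
    by (meson norm_cauchy_schwarz norm_blinfun mult_right_mono norm_ge_zero order_trans)
  finally have "norm (S y) * norm (S y) \<le> (norm T * norm y) * norm (S y)"
    by (simp add: ac_simps)
  then show "norm (S y) \<le> norm T * norm y"
    by (metis mult_le_cancel_right norm_ge_zero mult_nonneg_nonneg order_le_less order.trans)
qed simp

section \<open>The spectrum of a selfadjoint operator\<close>

definition bounded_below :: "('a::real_normed_vector \<Rightarrow>\<^sub>L 'a) \<Rightarrow> bool"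
  where "bounded_below T \<longleftrightarrow> (\<exists>c>0. \<forall>x. c * norm x \<le> norm (T x))"

abbreviation shift :: "('a::complex_inner \<Rightarrow>\<^sub>L 'a) \<Rightarrow> complex \<Rightarrow> ('a \<Rightarrow>\<^sub>L 'a)"
  where "shift A z \<equiv> A - scaleC_op z id_blinfun"

lemma shift_apply: "shift A z x = A x - z *\<^sub>C x"
  by (simp add: blinfun.diff_left scaleC_op.rep_eq)

lemma shift_bounded_ops: "A \<in> bounded_ops \<Longrightarrow> shift A z \<in> bounded_ops"
  by (simp add: bounded_ops_def shift_apply complex_vector.scale_right_diff_distrib mult.commute)

lemma bounded_below_compose:
  assumes "bounded_below S" "bounded_below T"
  shows "bounded_below (S o\<^sub>L T)"
proof -
  obtain c d where cd: "c > 0" "\<And>x. c * norm x \<le> norm (S x)"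
    "d > 0" "\<And>x. d * norm x \<le> norm (T x)"
    using assms unfolding bounded_below_def by blast
  have "c * d * norm x \<le> norm ((S o\<^sub>L T) x)" for x
  proof -
    have "c * d * norm x \<le> c * norm (T x)"
      using cd(1,4) by (simp add: mult.assoc)
    also have "\<dots> \<le> norm ((S o\<^sub>L T) x)"
      using cd(2) by simp
    finally show ?thesis .
  qed
  then show ?thesis
    using cd unfolding bounded_below_def by (metis mult_pos_pos)
qed

text \<open>The Lax-Milgram theorem for a single operator: for a small step \<open>e\<close> the map
  \<open>x \<mapsto> x - e (P x - y)\<close> is a contraction, and its fixed point solves \<open>P x = y\<close>.\<close>

lemma coercive_surj:
  fixes P :: "'a::{real_inner, complete_space} \<Rightarrow>\<^sub>L 'a"
  assumes "c > 0" and P: "\<And>x. c * (norm x)\<^sup>2 \<le> inner (P x) x"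
  shows "surj P"
proof -
  \<comment> \<open>The square of the Lipschitz constant is at most \<open>1 - 2 e c + e\<^sup>2 \<parallel>P\<parallel>\<^sup>2\<close>, and this choice of \<open>e\<close> makes
     the last term at most \<open>e c\<close>.  On the trivial space \<open>1 - e c\<close> can be negative, hence the maximum.\<close>
  define e where "e = c / ((norm P)\<^sup>2 + 1)"
  define k where "k = sqrt (max 0 (1 - e * c))"
  have e: "e > 0"
    using \<open>c > 0\<close> by (simp add: e_def add_nonneg_pos)
  have eP: "e * (norm P)\<^sup>2 \<le> c"
    using \<open>c > 0\<close> zero_le_power2[of "norm P"]
    by (simp add: e_def pos_divide_le_eq add_nonneg_pos distrib_left)
  have k: "0 \<le> k" "k < 1" "k\<^sup>2 = max 0 (1 - e * c)"
    using e \<open>c > 0\<close> by (auto simp: k_def)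
  have contr: "norm (x - e *\<^sub>R P x) \<le> k * norm x" for x
  proof -
    have "(norm (x - e *\<^sub>R P x))\<^sup>2 = (norm x)\<^sup>2 - 2 * e * inner (P x) x + e\<^sup>2 * (norm (P x))\<^sup>2"
      unfolding power2_norm_eq_inner
      by (simp add: inner_diff_left inner_diff_right inner_commute algebra_simps power2_eq_square)
    also have "e\<^sup>2 * (norm (P x))\<^sup>2 \<le> e\<^sup>2 * ((norm P)\<^sup>2 * (norm x)\<^sup>2)"
      using norm_blinfun[of P x]
      by (metis mult_left_mono norm_ge_zero power_mono power_mult_distrib zero_le_power2)
    also have "\<dots> = e * (norm x)\<^sup>2 * (e * (norm P)\<^sup>2)"
      by (simp add: power2_eq_square)
    also have "\<dots> \<le> e * (norm x)\<^sup>2 * c"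
      using eP e by (intro mult_left_mono) auto
    finally have "(norm (x - e *\<^sub>R P x))\<^sup>2
        \<le> (norm x)\<^sup>2 - 2 * (e * inner (P x) x) + e * (norm x)\<^sup>2 * c"
      by simp
    moreover have "e * (c * (norm x)\<^sup>2) \<le> e * inner (P x) x"
      using P[of x] e by simp
    ultimately have "(norm (x - e *\<^sub>R P x))\<^sup>2 \<le> (1 - e * c) * (norm x)\<^sup>2"
      by (simp add: algebra_simps)
    also have "\<dots> \<le> k\<^sup>2 * (norm x)\<^sup>2"
      unfolding k(3) by (intro mult_right_mono) auto
    finally show ?thesis
      by (metis k(1) mult_nonneg_nonneg norm_ge_zero power2_le_imp_le power_mult_distrib)
  qed
  have "y \<in> range P" for y
  proof -
    have "\<exists>!x. x - e *\<^sub>R (P x - y) = x"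
    proof (rule banach_fix_type[of k], use k in simp, use k in simp, intro allI)
      fix u v
      show "dist (u - e *\<^sub>R (P u - y)) (v - e *\<^sub>R (P v - y)) \<le> k * dist u v"
        using contr[of "u - v"] by (simp add: dist_norm blinfun.diff_right algebra_simps)
    qed
    then show ?thesis
      using e by auto
  qed
  then show ?thesis by blast
qed

lemma shift_adjoint:
  assumes "selfadjoint A"
  shows "inner (shift A z x) y = inner x (shift A (cnj z) y)"
  using assms by (simp add: selfadjoint_iff_inner shift_apply inner_diff_left inner_diff_right
      inner_scaleC_left)

text \<open>A shift \<open>N\<close> of a selfadjoint operator is normal, so \<open>N\<^sup>* N = N N\<^sup>*\<close> is coercive once
  \<open>N\<close> is bounded below; surjectivity of \<open>N N\<^sup>*\<close> passes to \<open>N\<close>.\<close>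

lemma bounded_below_shift_surj:
  fixes A :: "'a::chilbert_space \<Rightarrow>\<^sub>L 'a"
  assumes A: "selfadjoint A" and "bounded_below (shift A z)"
  shows "surj (shift A z)"
proof -
  let ?N = "shift A z" and ?N' = "shift A (cnj z)"
  obtain c where c: "c > 0" "\<And>x. c * norm x \<le> norm (?N x)"
    using assms unfolding bounded_below_def by blast
  have com: "?N (?N' x) = ?N' (?N x)" for x
    using A by (simp add: selfadjoint_def bounded_ops_def shift_apply blinfun.diff_right
        complex_vector.scale_right_diff_distrib mult.commute)
  have "c\<^sup>2 * (norm x)\<^sup>2 \<le> inner ((?N o\<^sub>L ?N') x) x" for x
  proof -
    have "c\<^sup>2 * (norm x)\<^sup>2 \<le> (norm (?N x))\<^sup>2"
      using power_mono[OF c(2)[of x], of 2] c(1) by (simp add: power_mult_distrib)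
    also have "\<dots> = inner (?N' (?N x)) x"
      using shift_adjoint[OF A, of z x "?N x"]
      by (simp add: power2_norm_eq_inner inner_commute)
    finally show ?thesis
      by (simp add: com)
  qed
  then have "surj (?N o\<^sub>L ?N')"
    using c(1) by (intro coercive_surj[of "c\<^sup>2"]) auto
  moreover have "range (?N o\<^sub>L ?N') \<subseteq> range ?N"
    by auto
  ultimately show ?thesis by blast
qed

lemma bounded_below_surj_inverse:
  assumes N: "N \<in> bounded_ops" "bounded_below N" "surj N"
  shows "\<exists>S\<in>bounded_ops. S o\<^sub>L N = id_blinfun \<and> N o\<^sub>L S = id_blinfun"
proof -
  obtain c where c: "c > 0" "\<And>x. c * norm x \<le> norm (N x)"
    using assms unfolding bounded_below_def by blast
  have inj: "x = y" if "N x = N y" for x y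
    using c(2)[of "x - y"] c(1) that
    by (auto simp: blinfun.diff_right mult_le_0_iff)
  define S where "S = inv N"
  have NS: "N (S y) = y" for y
    using N(3) by (simp add: S_def surj_f_inv_f)
  have SN: "S (N x) = x" for x
    by (rule inj) (rule NS)
  have bl: "bounded_linear S"
  proof (rule bounded_linear_intro[of _ "1 / c"])
    show "S (x + y) = S x + S y" for x y
      by (rule inj) (simp add: NS blinfun.add_right)
    show "S (r *\<^sub>R x) = r *\<^sub>R S x" for r x
      by (rule inj) (simp add: NS blinfun.scaleR_right)
    show "norm (S x) \<le> norm x * (1 / c)" for x
      using c(2)[of "S x"] c(1) by (simp add: NS field_simps)
  qed
  have "S (w *\<^sub>C x) = w *\<^sub>C S x" for w x
    by (rule inj) (simp add: NS blinfun_apply_bounded_ops[OF N(1)])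
  then show ?thesis
    using bl by (intro bexI[of _ "Blinfun S"])
      (auto simp: bounded_ops_def bounded_linear_Blinfun_apply blinfun_eqI NS SN
        intro!: blinfun_eqI)
qed

text \<open>A shift that is bounded below is also surjective and so has a bounded inverse; hence every point
  of the spectrum is an approximate eigenvalue.\<close>

theorem spectrum_selfadjoint_iff:
  fixes A :: "'a::chilbert_space \<Rightarrow>\<^sub>L 'a"
  assumes A: "selfadjoint A"
  shows "z \<in> spectrum A \<longleftrightarrow> \<not> bounded_below (shift A z)"
proof -
  have "bounded_below N" if "S o\<^sub>L N = id_blinfun" for S N :: "'a \<Rightarrow>\<^sub>L 'a"
  proof -
    have "norm x / (norm S + 1) \<le> norm (N x)" for x
    proof -
      have "norm x = norm (S (N x))"
        by (metis blinfun_apply_blinfun_compose blinfun_apply_id_blinfun that)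
      also have "\<dots> \<le> (norm S + 1) * norm (N x)"
        using norm_blinfun[of S "N x"] norm_ge_zero[of "N x"]
        unfolding distrib_right by linarith
      finally show ?thesis
        by (subst pos_divide_le_eq) (auto simp: add_nonneg_pos mult.commute)
    qed
    then show ?thesis
      unfolding bounded_below_def by (intro exI[of _ "1 / (norm S + 1)"]) (simp add: add_nonneg_pos)
  qed
  then show ?thesis
    using bounded_below_surj_inverse[OF shift_bounded_ops _ bounded_below_shift_surj[OF A], of z] A
    unfolding spectrum_def selfadjoint_def by blast
qed

text \<open>The form \<open>\<langle>A x, x\<rangle>\<close> is real, so \<open>\<langle>(A - z) x, x\<rangle>\<close> has imaginary part \<open>- Im z \<parallel>x\<parallel>\<^sup>2\<close>.\<close>

lemma spectrum_selfadjoint_real: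
  fixes A :: "'a::chilbert_space \<Rightarrow>\<^sub>L 'a"
  assumes A: "selfadjoint A" and z: "z \<in> spectrum A"
  shows "Im z = 0"
proof (rule ccontr)
  assume *: "Im z \<noteq> 0"
  have "\<bar>Im z\<bar> * norm x \<le> norm (shift A z x)" for x
  proof -
    have "inner (A x) (\<i> *\<^sub>C x) = 0"
    proof -
      have "inner (A x) (\<i> *\<^sub>C x) = inner x (\<i> *\<^sub>C A x)"
        using A by (metis selfadjoint_iff_inner blinfun_apply_bounded_ops)
      also have "\<dots> = - inner (\<i> *\<^sub>C x) (A x)"
        by (simp add: inner_scaleC_left)
      finally show ?thesis
        by (simp add: inner_commute)
    qed
    moreover have "inner (z *\<^sub>C x) (\<i> *\<^sub>C x) = Im z * (norm x)\<^sup>2"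
      by (simp add: inner_eq_Re_cinner inner_scaleC_left cinner_scaleC_left
          cinner_commute[of x "_ *\<^sub>C x"] cinner_self_norm flip: of_real_power)
    ultimately have "\<bar>Im z\<bar> * (norm x)\<^sup>2 = \<bar>inner (shift A z x) (\<i> *\<^sub>C x)\<bar>"
      by (simp add: shift_apply inner_diff_left abs_mult)
    also have "\<dots> \<le> norm (shift A z x) * norm x"
      using Cauchy_Schwarz_ineq2[of "shift A z x" "\<i> *\<^sub>C x"] by (simp add: norm_scaleC)
    finally show ?thesis
      by (cases "x = 0") (auto simp: power2_eq_square)
  qed
  then have "bounded_below (shift A z)"
    using * unfolding bounded_below_def by (metis zero_less_abs_iff)
  then show False
    using z A by (simp add: spectrum_selfadjoint_iff)
qed

section \<open>Polynomials of an operator\<close>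

definition op_poly :: "complex poly \<Rightarrow> ('a::complex_inner \<Rightarrow>\<^sub>L 'a) \<Rightarrow> ('a \<Rightarrow>\<^sub>L 'a)"
  where "op_poly p A = fold_coeffs (\<lambda>a T. scaleC_op a id_blinfun + (A o\<^sub>L T)) p 0"

lemma op_poly_0 [simp]: "op_poly 0 A = 0"
  by (simp add: op_poly_def)

lemma scaleC_op_0 [simp]: "scaleC_op 0 T = 0"
  by (rule blinfun_eqI) (simp add: scaleC_op.rep_eq)

lemma scaleC_op_1 [simp]: "scaleC_op 1 T = T"
  by (rule blinfun_eqI) (simp add: scaleC_op.rep_eq)

lemma blinfun_compose_0_right [simp]: "S o\<^sub>L 0 = 0"
  by (rule bounded_bilinear.zero_right[OF bounded_bilinear_blinfun_compose])

lemma op_poly_pCons [simp]: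
  "op_poly (pCons a p) A = scaleC_op a id_blinfun + (A o\<^sub>L op_poly p A)"
  by (cases "p = 0"; cases "a = 0")
    (simp_all add: op_poly_def)

lemma op_poly_pCons_apply:
  "op_poly (pCons a p) A x = a *\<^sub>C x + A (op_poly p A x)"
  by (simp add: blinfun.add_left scaleC_op.rep_eq)

lemma op_poly_bounded_ops:
  assumes "A \<in> bounded_ops"
  shows "op_poly p A \<in> bounded_ops"
proof (induction p)
  case 0
  show ?case by (simp add: bounded_ops_def)
next
  case (pCons a p)
  have "op_poly (pCons a p) A (c *\<^sub>C x) = c *\<^sub>C op_poly (pCons a p) A x" for c x
    unfolding op_poly_pCons_apply
    by (simp add: blinfun_apply_bounded_ops[OF assms]
        blinfun_apply_bounded_ops[OF pCons.IH] complex_vector.scale_right_distrib mult.commute)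
  then show ?case
    unfolding bounded_ops_def by blast
qed

lemma op_poly_add: "op_poly (p + q) A = op_poly p A + op_poly q A"
proof (rule blinfun_eqI)
  show "op_poly (p + q) A x = (op_poly p A + op_poly q A) x" for x
    by (induction p q rule: poly_induct2)
      (simp_all add: blinfun.add_left blinfun.add_right scaleC_op.rep_eq
        complex_vector.scale_left_distrib del: op_poly_pCons add: op_poly_pCons_apply)
qed

lemma op_poly_smult:
  assumes "A \<in> bounded_ops"
  shows "op_poly (smult c p) A = scaleC_op c (op_poly p A)"
proof (rule blinfun_eqI)
  show "op_poly (smult c p) A x = scaleC_op c (op_poly p A) x" for x
    by (induction p)
      (simp_all add: scaleC_op.rep_eq complex_vector.scale_right_distrib
        blinfun_apply_bounded_ops[OF assms] del: op_poly_pCons add: op_poly_pCons_apply)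
qed

lemma op_poly_diff:
  assumes "A \<in> bounded_ops"
  shows "op_poly (p - q) A = op_poly p A - op_poly q A"
proof -
  have "op_poly (p - q) A + op_poly q A = op_poly p A"
    by (simp flip: op_poly_add)
  then show ?thesis
    by (simp add: algebra_simps)
qed

lemma op_poly_mult:
  assumes "A \<in> bounded_ops"
  shows "op_poly (p * q) A = op_poly p A o\<^sub>L op_poly q A"
proof (rule blinfun_eqI)
  show "op_poly (p * q) A x = (op_poly p A o\<^sub>L op_poly q A) x" for x
    by (induction p)
      (simp_all add: blinfun.add_left op_poly_add op_poly_smult[OF assms] scaleC_op.rep_eq
        del: op_poly_pCons add: op_poly_pCons_apply)
qed

lemma op_poly_X: "op_poly [:0, 1:] A = A"
  by (rule blinfun_eqI) (simp add: op_poly_pCons_apply del: op_poly_pCons)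

lemma op_poly_commute:
  assumes "A \<in> bounded_ops"
  shows "A (op_poly p A x) = op_poly p A (A x)"
proof -
  have "op_poly (p * [:0, 1:]) A = op_poly ([:0, 1:] * p) A"
    by (simp add: mult.commute)
  then have "op_poly p A (op_poly [:0, 1:] A x) = op_poly [:0, 1:] A (op_poly p A x)"
    unfolding op_poly_mult[OF assms] by (metis blinfun_apply_blinfun_compose)
  then show ?thesis
    by (simp only: op_poly_X)
qed

lemma op_poly_linear_factor: "op_poly [:- z, 1:] A = shift A z"
  by (rule blinfun_eqI)
    (simp add: op_poly_pCons_apply shift_apply del: op_poly_pCons)

lemma op_poly_adjoint:
  assumes "selfadjoint A"
  shows "is_adjoint (op_poly (map_poly cnj p) A) (op_poly p A)"
proof -
  have A: "A \<in> bounded_ops" "\<And>x y. inner (A x) y = inner x (A y)"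
    using assms by (auto simp: selfadjoint_iff_inner)
  have "inner (op_poly p A x) y = inner x (op_poly (map_poly cnj p) A y)" for x y
  proof (induction p arbitrary: x y)
    case (pCons a p)
    have "inner (op_poly (pCons a p) A x) y = inner x (cnj a *\<^sub>C y) + inner (op_poly p A x) (A y)"
      by (simp only: op_poly_pCons_apply inner_add_left inner_scaleC_left A(2))
    also have "\<dots> = inner x (cnj a *\<^sub>C y + A (op_poly (map_poly cnj p) A y))"
      by (simp only: pCons.IH inner_add_right op_poly_commute[OF A(1)])
    finally show ?case
      by (simp only: map_poly_pCons complex_cnj_zero op_poly_pCons_apply)
  qed simp
  then show ?thesis
    using is_adjoint_iff_inner op_poly_bounded_ops A(1) by blast
qed

section \<open>The norm of a polynomial of a selfadjoint operator\<close>

text \<open>With \<open>m = \<parallel>T\<parallel>\<^sup>2\<close>, expanding the square gives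
  \<open>\<parallel>T\<^sup>* T x - m x\<parallel>\<^sup>2 \<le> 2 m\<^sup>2 \<parallel>x\<parallel>\<^sup>2 - 2 m \<parallel>T x\<parallel>\<^sup>2\<close>, which is small relative to \<open>\<parallel>x\<parallel>\<^sup>2\<close> where \<open>T\<close>
  nearly attains its norm.  So \<open>m\<close> is an approximate eigenvalue of \<open>T\<^sup>* T\<close>.  The vector \<open>x0\<close> excludes
  the trivial space, where every operator is bounded below.\<close>

lemma adjoint_compose_shift_not_bounded_below:
  fixes T :: "'a::complex_inner \<Rightarrow>\<^sub>L 'a"
  assumes "is_adjoint S T" and "x0 \<noteq> (0::'a)"
  shows "\<not> bounded_below (shift (S o\<^sub>L T) (complex_of_real ((norm T)\<^sup>2)))"
proof
  define m where "m = (norm T)\<^sup>2"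
  assume "bounded_below (shift (S o\<^sub>L T) (complex_of_real ((norm T)\<^sup>2)))"
  then obtain c where c: "c > 0" "\<And>x. c * norm x \<le> norm (S (T x) - m *\<^sub>R x)"
    unfolding bounded_below_def shift_apply by (auto simp: m_def scaleR_scaleC)
  have main: "2 * m * (norm (T x))\<^sup>2 \<le> (2 * m\<^sup>2 - c\<^sup>2) * (norm x)\<^sup>2" for x
  proof -
    have "norm (S (T x)) \<le> norm T * (norm T * norm x)"
      by (meson assms(1) mult_mono norm_adjoint_le norm_blinfun norm_ge_zero order_trans)
    then have "(norm (S (T x)))\<^sup>2 \<le> (norm T * (norm T * norm x))\<^sup>2"
      by (intro power_mono) auto
    then have STx: "(norm (S (T x)))\<^sup>2 \<le> m\<^sup>2 * (norm x)\<^sup>2"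
      by (simp add: m_def power2_eq_square ac_simps)
    have "c\<^sup>2 * (norm x)\<^sup>2 \<le> (norm (S (T x) - m *\<^sub>R x))\<^sup>2"
      using power_mono[OF c(2)[of x], of 2] c(1) by (simp add: power_mult_distrib)
    also have "\<dots> = (norm (S (T x)))\<^sup>2 - 2 * m * inner x (S (T x)) + m\<^sup>2 * (norm x)\<^sup>2"
      unfolding power2_norm_eq_inner
      by (simp add: inner_diff_left inner_diff_right inner_commute algebra_simps power2_eq_square)
    also have "inner x (S (T x)) = (norm (T x))\<^sup>2"
      by (simp add: is_adjointD[OF assms(1), symmetric] power2_norm_eq_inner)
    finally show ?thesis
      using STx by (simp add: algebra_simps)
  qed
  show False
  proof (cases "T = 0")
    case True
    then show False
      using c(1) c(2)[of x0] assms(2) by (simp add: m_def mult_le_0_iff blinfun.zero_right)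
  next
    case False
    then have m: "m > 0"
      by (simp add: m_def)
    \<comment> \<open>\<open>main\<close> improves the bound \<open>\<parallel>T x\<parallel>\<^sup>2 \<le> m \<parallel>x\<parallel>\<^sup>2\<close> to a constant smaller than \<open>m\<close>, against the
       definition of the norm.\<close>
    define d where "d = max 0 (m - c\<^sup>2 / (2 * m))"
    have "norm T \<le> sqrt d"
    proof (rule norm_blinfun_bound)
      fix x
      have "(norm (T x))\<^sup>2 \<le> (m - c\<^sup>2 / (2 * m)) * (norm x)\<^sup>2"
        using main[of x] m by (simp add: field_simps power2_eq_square)
      also have "\<dots> \<le> d * (norm x)\<^sup>2"
        by (intro mult_right_mono) (auto simp: d_def)
      finally have "sqrt ((norm (T x))\<^sup>2) \<le> sqrt (d * (norm x)\<^sup>2)"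
        by (rule real_sqrt_le_mono)
      then show "norm (T x) \<le> sqrt d * norm x"
        by (simp add: real_sqrt_mult)
    qed (simp add: d_def)
    then have "m \<le> d"
      unfolding m_def by (metis norm_ge_zero power_mono real_sqrt_pow2 d_def max.cobounded1)
    then show False
      using m divide_pos_pos[of "c\<^sup>2" "2 * m", OF zero_less_power[OF c(1)]]
      unfolding d_def by linarith
  qed
qed

text \<open>A polynomial of \<open>A\<close> is a product of shifts of \<open>A\<close> by its roots, so it can only fail to be bounded
  below if one of these shifts does.\<close>

lemma op_poly_bounded_below:
  assumes A: "A \<in> bounded_ops" and "q \<noteq> 0"
    and "\<And>r. poly q r = 0 \<Longrightarrow> bounded_below (shift A r)"
  shows "bounded_below (op_poly q A)"
  using assms(2,3)
proof (induction "degree q" arbitrary: q)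
  case 0
  then obtain a where q: "q = [:a:]" "a \<noteq> 0"
    by (metis degree_eq_zeroE pCons_0_0)
  then show ?case
    by (auto simp: bounded_below_def scaleC_op.rep_eq norm_scaleC intro!: exI[of _ "cmod a"])
next
  case (Suc n)
  then obtain r where r: "poly q r = 0"
    using fundamental_theorem_of_algebra[of q] by (auto simp: constant_degree)
  then obtain p where p: "q = [:- r, 1:] * p"
    unfolding poly_eq_0_iff_dvd by blast
  have "p \<noteq> 0"
    using Suc.prems p by auto
  moreover from this have "degree p = n"
    using Suc.hyps(2) p by (simp add: degree_mult_eq del: mult_pCons_left)
  ultimately have "bounded_below (op_poly p A)"
    using Suc.prems(2) p by (intro Suc.hyps(1)) auto
  then show ?case
    unfolding p op_poly_mult[OF A] op_poly_linear_factor
    using Suc.prems(2) r by (intro bounded_below_compose) auto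
qed

text \<open>The contrapositive: approximate eigenvalues of a polynomial of \<open>A\<close> come from points of the
  spectrum of \<open>A\<close>.\<close>

lemma spectrum_meets_roots:
  fixes A :: "'a::chilbert_space \<Rightarrow>\<^sub>L 'a"
  assumes "selfadjoint A" "q \<noteq> 0" "\<not> bounded_below (op_poly q A)"
  obtains r where "r \<in> spectrum A" "poly q r = 0"
  using op_poly_bounded_below[of A q] assms
  by (auto simp: spectrum_selfadjoint_iff selfadjoint_def)

lemma op_poly_const_sub:
  assumes "A \<in> bounded_ops"
  shows "op_poly (p - [:c:]) A = shift (op_poly p A) c"
  by (simp add: op_poly_diff[OF assms])

text \<open>For real \<open>\<mu> = \<parallel>A\<parallel>\<close> the operator \<open>A\<^sup>2 - \<mu>\<^sup>2\<close> is not bounded below, so \<open>\<mu>\<close> or \<open>- \<mu>\<close> lies in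
  the spectrum.\<close>

lemma spectrum_nonempty:
  fixes A :: "'a::chilbert_space \<Rightarrow>\<^sub>L 'a"
  assumes A: "selfadjoint A" and "x0 \<noteq> (0::'a)"
  shows "spectrum A \<noteq> {}"
proof -
  let ?q = "[:0, 1:] * [:0, 1:] - [:complex_of_real ((norm A)\<^sup>2):]"
  have Ab: "A \<in> bounded_ops" and AA: "is_adjoint A A"
    using A by (auto simp: selfadjoint_def)
  have "op_poly ?q A = shift (A o\<^sub>L A) (complex_of_real ((norm A)\<^sup>2))"
    unfolding op_poly_const_sub[OF Ab] op_poly_mult[OF Ab] op_poly_X ..
  then have "\<not> bounded_below (op_poly ?q A)"
    using adjoint_compose_shift_not_bounded_below[OF AA assms(2)] by simp
  then show ?thesis
    using spectrum_meets_roots[OF A, of ?q] by auto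
qed

text \<open>The statement by upper bounds avoids a supremum over the spectrum, which is empty on the
  trivial space.\<close>

theorem norm_op_poly_le_iff:
  fixes A :: "'a::chilbert_space \<Rightarrow>\<^sub>L 'a"
  assumes A: "selfadjoint A" and "M \<ge> 0"
  shows "norm (op_poly p A) \<le> M \<longleftrightarrow> (\<forall>z\<in>spectrum A. cmod (poly p z) \<le> M)"
proof -
  have Ab: "A \<in> bounded_ops"
    using A by (auto simp: selfadjoint_def)
  show ?thesis
  proof
    assume M: "norm (op_poly p A) \<le> M"
    \<comment> \<open>If \<open>|p(z)| > M\<close> then \<open>p(A) - p(z)\<close> is bounded below, and so is its factor \<open>A - z\<close>.\<close>
    show "\<forall>z\<in>spectrum A. cmod (poly p z) \<le> M"
    proof (rule ballI, rule ccontr)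
      fix z
      assume z: "z \<in> spectrum A" and "\<not> cmod (poly p z) \<le> M"
      then have gap: "0 < cmod (poly p z) - M" by simp
      have "poly (p - [:poly p z:]) z = 0" by simp
      then obtain q where "p - [:poly p z:] = [:- z, 1:] * q"
        unfolding poly_eq_0_iff_dvd by blast
      then have q: "shift (op_poly p A) (poly p z) = op_poly q A o\<^sub>L shift A z"
        by (metis op_poly_const_sub[OF Ab] op_poly_linear_factor op_poly_mult[OF Ab] mult.commute)
      have "(cmod (poly p z) - M) / (norm (op_poly q A) + 1) * norm x \<le> norm (shift A z x)" for x
      proof -
        have "norm (poly p z *\<^sub>C x) \<le> norm (op_poly p A x) + norm (shift (op_poly p A) (poly p z) x)"
          unfolding shift_apply by (metis norm_triangle_sub norm_minus_commute)
        also have "norm (op_poly p A x) \<le> M * norm x"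
          using M by (meson mult_right_mono norm_blinfun norm_ge_zero order_trans)
        also have "norm (shift (op_poly p A) (poly p z) x) \<le> norm (op_poly q A) * norm (shift A z x)"
          unfolding q by (simp add: norm_blinfun)
        finally have "(cmod (poly p z) - M) * norm x \<le> (norm (op_poly q A) + 1) * norm (shift A z x)"
          using norm_ge_zero[of "shift A z x"] unfolding norm_scaleC distrib_right left_diff_distrib by linarith
        moreover have "norm (op_poly q A) + 1 > 0"
          by (simp add: add_nonneg_pos)
        ultimately show ?thesis
          by (simp add: pos_divide_le_eq mult.commute)
      qed
      moreover have "(cmod (poly p z) - M) / (norm (op_poly q A) + 1) > 0"
        using gap by (simp add: add_nonneg_pos)
      ultimately have "bounded_below (shift A z)"
        unfolding bounded_below_def by blast
      then show False
        using z by (simp add: spectrum_selfadjoint_iff[OF A])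
    qed
  next
    assume M: "\<forall>z\<in>spectrum A. cmod (poly p z) \<le> M"
    let ?T = "op_poly p A"
    show "norm ?T \<le> M"
    proof (rule ccontr)
      assume neg: "\<not> norm ?T \<le> M"
      then have "?T \<noteq> 0"
        using \<open>M \<ge> 0\<close> by auto
      then obtain x0 :: 'a where x0: "x0 \<noteq> 0"
        by (metis blinfun_eqI)
      define q where "q = map_poly cnj p * p - [:complex_of_real ((norm ?T)\<^sup>2):]"
      have q: "op_poly q A = shift (op_poly (map_poly cnj p) A o\<^sub>L ?T) (complex_of_real ((norm ?T)\<^sup>2))"
        unfolding q_def op_poly_const_sub[OF Ab] op_poly_mult[OF Ab] ..
      \<comment> \<open>If \<open>q = 0\<close>, as happens for constant \<open>p\<close>, any point of the spectrum serves as \<open>r\<close>.\<close>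
      obtain r where r: "r \<in> spectrum A" "poly q r = 0"
      proof (cases "q = 0")
        case True
        then show ?thesis
          using that spectrum_nonempty[OF A x0] by fastforce
      next
        case False
        then show ?thesis
          using that spectrum_meets_roots[OF A False] q
            adjoint_compose_shift_not_bounded_below[OF op_poly_adjoint[OF A] x0] by metis
      qed
      have "cnj r = r"
        using spectrum_selfadjoint_real[OF A r(1)] by (simp add: complex_eq_iff)
      then have "poly (map_poly cnj p) r = cnj (poly p r)"
        by (metis poly_cnj)
      then have "cnj (poly p r) * poly p r = complex_of_real ((norm ?T)\<^sup>2)"
        using r(2) by (simp add: q_def)
      then have "complex_of_real ((cmod (poly p r))\<^sup>2) = complex_of_real ((norm ?T)\<^sup>2)"
        using complex_norm_square[of "poly p r"] mult.commute[of "poly p r" "cnj (poly p r)"]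
        by argo
      then have "(cmod (poly p r))\<^sup>2 = (norm ?T)\<^sup>2"
        by (rule of_real_eq_iff[THEN iffD1])
      then have "cmod (poly p r) = norm ?T"
        by (rule power2_eq_imp_eq) simp_all
      then show False
        using M r(1) neg by auto
    qed
  qed
qed

section \<open>Approximation by polynomials on the spectrum\<close>

lemma compact_spectrum:
  fixes A :: "'a::chilbert_space \<Rightarrow>\<^sub>L 'a"
  assumes A: "selfadjoint A"
  shows "compact (spectrum A)"
proof -
  have "open (- spectrum A)"
    unfolding open_dist
  proof
    fix z
    assume "z \<in> - spectrum A"
    then obtain c where c: "c > 0" "\<And>x. c * norm x \<le> norm (shift A z x)"
      by (auto simp: spectrum_selfadjoint_iff[OF A] bounded_below_def)
    have "w \<in> - spectrum A" if w: "dist w z < c" for w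
    proof -
      have "(c - cmod (w - z)) * norm x \<le> norm (shift A w x)" for x
      proof -
        have "shift A w x = shift A z x - (w - z) *\<^sub>C x"
          by (simp add: shift_apply complex_vector.scale_left_diff_distrib)
        then have "norm (shift A z x) - cmod (w - z) * norm x \<le> norm (shift A w x)"
          by (metis norm_scaleC norm_triangle_ineq2)
        then show ?thesis
          using c(2)[of x] by (simp add: left_diff_distrib)
      qed
      then have "bounded_below (shift A w)"
        using w unfolding bounded_below_def dist_norm by (metis diff_gt_0_iff_gt)
      then show ?thesis
        by (simp add: spectrum_selfadjoint_iff[OF A])
    qed
    then show "\<exists>e>0. \<forall>w. dist w z < e \<longrightarrow> w \<in> - spectrum A"
      using c(1) by blast
  qed
  moreover have "cmod z \<le> norm (op_poly [:0, 1:] A)" if "z \<in> spectrum A" for z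
    using norm_op_poly_le_iff[OF A norm_ge_zero, of "[:0, 1:]"] that by auto
  then have "bounded (spectrum A)"
    unfolding bounded_iff by blast
  ultimately show ?thesis
    by (simp add: compact_eq_bounded_closed closed_def)
qed

lemma complex_poly_approximates_on_reals:
  fixes h :: "real \<Rightarrow> real"
  assumes "compact X" "continuous_on X h" "e > 0"
  obtains p where "\<And>x. x \<in> X \<Longrightarrow> cmod (poly p (complex_of_real x) - complex_of_real (h x)) < e"
proof -
  obtain k where k: "real_polynomial_function k" "\<And>x. x \<in> X \<Longrightarrow> \<bar>h x - k x\<bar> < e"
    using Stone_Weierstrass_real_polynomial_function[OF assms] by blast
  obtain a n where kan: "k = (\<lambda>x. \<Sum>i\<le>n. a i * x ^ i)"
    using k(1) by (auto simp: real_polynomial_function_iff_sum)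
  define p where "p = (\<Sum>i\<le>n. monom (complex_of_real (a i)) i)"
  have "poly p (complex_of_real x) = complex_of_real (k x)" for x
    by (simp add: p_def kan poly_sum poly_monom)
  then have "cmod (poly p (complex_of_real x) - complex_of_real (h x)) < e" if "x \<in> X" for x
    using k(2)[OF that] by (metis abs_minus_commute norm_of_real of_real_diff)
  then show ?thesis
    using that by blast
qed

lemma poly_approximates_on_spectrum:
  fixes A :: "'a::chilbert_space \<Rightarrow>\<^sub>L 'a"
  assumes A: "selfadjoint A" and g: "continuous_on (spectrum A) g" and "e > 0"
  obtains p where "\<And>z. z \<in> spectrum A \<Longrightarrow> cmod (poly p z - g z) < e"
proof -
  define X where "X = Re ` spectrum A"
  have real: "complex_of_real (Re z) = z" if "z \<in> spectrum A" for z
    using spectrum_selfadjoint_real[OF A that] by (simp add: complex_eq_iff)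
  have X: "compact X"
    unfolding X_def by (intro compact_continuous_image compact_spectrum A continuous_intros)
  have "continuous_on X (\<lambda>x. g (complex_of_real x))"
    by (rule continuous_on_compose2[OF g]) (auto simp: X_def real intro: continuous_intros)
  then have "continuous_on X (\<lambda>x. Re (g (complex_of_real x)))"
    "continuous_on X (\<lambda>x. Im (g (complex_of_real x)))"
    by (auto intro: continuous_intros)
  then obtain p q where
    p: "\<And>x. x \<in> X \<Longrightarrow> cmod (poly p (complex_of_real x) - complex_of_real (Re (g (complex_of_real x)))) < e / 2"
    and q: "\<And>x. x \<in> X \<Longrightarrow> cmod (poly q (complex_of_real x) - complex_of_real (Im (g (complex_of_real x)))) < e / 2"
    using complex_poly_approximates_on_reals[OF X _ half_gt_zero[OF \<open>e > 0\<close>]] by metis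
  show ?thesis
  proof (rule that[of "p + smult \<i> q"])
    fix z
    assume z: "z \<in> spectrum A"
    have "poly (p + smult \<i> q) z - g z
        = (poly p z - complex_of_real (Re (g z))) + \<i> * (poly q z - complex_of_real (Im (g z)))"
      by (subst complex_eq[of "g z"]) (simp add: algebra_simps)
    also have "cmod \<dots> \<le> cmod (poly p z - complex_of_real (Re (g z)))
        + cmod (poly q z - complex_of_real (Im (g z)))"
      by (metis (no_types) mult_1 norm_ii norm_mult norm_triangle_ineq)
    also have "\<dots> < e"
      using p[of "Re z"] q[of "Re z"] z real[OF z] by (auto simp: X_def)
    finally show "cmod (poly (p + smult \<i> q) z - g z) < e" .
  qed
qed

section \<open>Existence and uniqueness of the continuous calculus\<close>

text \<open>The graph of the calculus of \<open>A\<close>.  Being a relation, it can be shown to respect sums, products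
  and adjoints before it is known to be a function.\<close>

definition poly_limit ::
    "('a::complex_inner \<Rightarrow>\<^sub>L 'a) \<Rightarrow> (complex \<Rightarrow> complex) \<Rightarrow> ('a \<Rightarrow>\<^sub>L 'a) \<Rightarrow> bool"
  where "poly_limit A g T \<longleftrightarrow> (\<exists>p.
    uniform_limit (spectrum A) (\<lambda>n. poly (p n)) g sequentially \<and>
    (\<lambda>n. op_poly (p n) A) \<longlonglongrightarrow> T)"

lemma poly_eq_fun:
  fixes p q :: "complex poly"
  shows "poly (p + q) = (\<lambda>z. poly p z + poly q z)" "poly (p * q) = (\<lambda>z. poly p z * poly q z)"
    "poly [:c:] = (\<lambda>z. c)" "poly [:0, 1:] = (\<lambda>z::complex. z)"
  by auto

lemma poly_limit_poly: "poly_limit A (poly p) (op_poly p A)"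
  unfolding poly_limit_def by (intro exI[of _ "\<lambda>_. p"]) (auto simp: uniform_limit_const)

lemma poly_limit_add:
  assumes "poly_limit A g T" "poly_limit A h S"
  shows "poly_limit A (\<lambda>z. g z + h z) (T + S)"
proof -
  obtain p q where "uniform_limit (spectrum A) (\<lambda>n. poly (p n)) g sequentially"
    "(\<lambda>n. op_poly (p n) A) \<longlonglongrightarrow> T"
    "uniform_limit (spectrum A) (\<lambda>n. poly (q n)) h sequentially"
    "(\<lambda>n. op_poly (q n) A) \<longlonglongrightarrow> S"
    using assms unfolding poly_limit_def by blast
  then show ?thesis
    unfolding poly_limit_def
    by (intro exI[of _ "\<lambda>n. p n + q n"])
      (auto simp: op_poly_add poly_eq_fun intro: uniform_limit_add tendsto_add)
qed

text \<open>Limits of polynomials inherit the norm formula: operator norms and suprema over the spectrum are both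
  continuous along the approximation.\<close>

lemma norm_poly_limit_le_iff:
  fixes A :: "'a::chilbert_space \<Rightarrow>\<^sub>L 'a"
  assumes A: "selfadjoint A" and "poly_limit A g T" and "M \<ge> 0"
  shows "norm T \<le> M \<longleftrightarrow> (\<forall>z\<in>spectrum A. cmod (g z) \<le> M)"
proof -
  obtain p where p: "uniform_limit (spectrum A) (\<lambda>n. poly (p n)) g sequentially"
    and T: "(\<lambda>n. op_poly (p n) A) \<longlonglongrightarrow> T"
    using assms(2) unfolding poly_limit_def by blast
  show ?thesis
  proof
    assume M: "norm T \<le> M"
    show "\<forall>z\<in>spectrum A. cmod (g z) \<le> M"
    proof
      fix z
      assume z: "z \<in> spectrum A"
      have "cmod (poly (p n) z) \<le> norm (op_poly (p n) A)" for n
        using norm_op_poly_le_iff[OF A norm_ge_zero[of "op_poly (p n) A"], of "p n"] z by simp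
      moreover have "(\<lambda>n. cmod (poly (p n) z)) \<longlonglongrightarrow> cmod (g z)"
        by (intro tendsto_norm tendsto_uniform_limitI[OF p z])
      ultimately have "cmod (g z) \<le> norm T"
        by (intro LIMSEQ_le[OF _ tendsto_norm[OF T]]) auto
      then show "cmod (g z) \<le> M"
        using M by simp
    qed
  next
    assume M: "\<forall>z\<in>spectrum A. cmod (g z) \<le> M"
    show "norm T \<le> M"
    proof (rule field_le_epsilon)
      fix e :: real
      assume e: "e > 0"
      have "eventually (\<lambda>n. norm (op_poly (p n) A) \<le> M + e) sequentially"
        using uniform_limitD[OF p e]
      proof eventually_elim
        case (elim n)
        have "cmod (poly (p n) z) \<le> M + e" if "z \<in> spectrum A" for z
        proof -
          have "cmod (poly (p n) z) \<le> cmod (g z) + dist (poly (p n) z) (g z)"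
            by (metis dist_norm norm_triangle_sub)
          then show ?thesis
            using M elim that by fastforce
        qed
        then show ?case
          using norm_op_poly_le_iff[OF A, of "M + e" "p n"] \<open>M \<ge> 0\<close> e by auto
      qed
      then show "norm T \<le> M + e"
        by (rule tendsto_upperbound[OF tendsto_norm[OF T]]) simp
    qed
  qed
qed

lemma poly_limit_mult:
  fixes A :: "'a::chilbert_space \<Rightarrow>\<^sub>L 'a"
  assumes A: "selfadjoint A" and g: "poly_limit A g T" and h: "poly_limit A h S"
  shows "poly_limit A (\<lambda>z. g z * h z) (T o\<^sub>L S)"
proof -
  have bdd: "bounded (g ` spectrum A)" "bounded (h ` spectrum A)"
    using norm_poly_limit_le_iff[OF A g norm_ge_zero, of T]
      norm_poly_limit_le_iff[OF A h norm_ge_zero, of S]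
    unfolding bounded_iff by blast+
  obtain p q where "uniform_limit (spectrum A) (\<lambda>n. poly (p n)) g sequentially"
    "(\<lambda>n. op_poly (p n) A) \<longlonglongrightarrow> T"
    "uniform_limit (spectrum A) (\<lambda>n. poly (q n)) h sequentially"
    "(\<lambda>n. op_poly (q n) A) \<longlonglongrightarrow> S"
    using g h unfolding poly_limit_def by blast
  moreover have "A \<in> bounded_ops"
    using A by (simp add: selfadjoint_def)
  ultimately show ?thesis
    unfolding poly_limit_def using bdd
    by (intro exI[of _ "\<lambda>n. p n * q n"])
      (auto simp: op_poly_mult poly_eq_fun intro!: uniform_lim_mult
        bounded_bilinear.tendsto[OF bounded_bilinear_blinfun_compose])
qed

lemma scaleC_op_eq_compose: "scaleC_op a T = scaleC_op a id_blinfun o\<^sub>L T"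
  by (rule blinfun_eqI) (simp add: scaleC_op.rep_eq)

lemma poly_limit_lincomb:
  fixes A :: "'a::chilbert_space \<Rightarrow>\<^sub>L 'a"
  assumes A: "selfadjoint A" and g: "poly_limit A g T" and h: "poly_limit A h S"
  shows "poly_limit A (\<lambda>z. a * g z + b * h z) (scaleC_op a T + scaleC_op b S)"
proof -
  have const: "poly_limit A (\<lambda>z. c) (scaleC_op c id_blinfun)" for c
    using poly_limit_poly[of A "[:c:]"] by (simp add: poly_eq_fun)
  show ?thesis
    using poly_limit_add[OF poly_limit_mult[OF A const g] poly_limit_mult[OF A const h]]
    by (simp flip: scaleC_op_eq_compose)
qed

lemma scaleC_op_minus_1 [simp]: "scaleC_op (- 1) T = - T"
  by (rule blinfun_eqI) (simp add: scaleC_op.rep_eq blinfun.minus_left)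

lemma poly_limit_unique:
  fixes A :: "'a::chilbert_space \<Rightarrow>\<^sub>L 'a"
  assumes A: "selfadjoint A" and "poly_limit A g T" "poly_limit A g S"
  shows "T = S"
proof -
  have "poly_limit A (\<lambda>z. 1 * g z + (- 1) * g z) (scaleC_op 1 T + scaleC_op (- 1) S)"
    by (intro poly_limit_lincomb assms)
  from norm_poly_limit_le_iff[OF A this, of 0]
  have "T + scaleC_op (- 1) S = 0"
    by simp
  then show ?thesis by simp
qed

text \<open>The norm formula turns uniform Cauchy sequences of polynomials into Cauchy sequences of
  operators.\<close>

lemma uniform_limit_imp_op_poly_convergent:
  fixes A :: "'a::chilbert_space \<Rightarrow>\<^sub>L 'a"
  assumes A: "selfadjoint A" and p: "uniform_limit (spectrum A) (\<lambda>n. poly (p n)) g sequentially"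
  shows "convergent (\<lambda>n. op_poly (p n) A)"
proof -
  have "Cauchy (\<lambda>n. op_poly (p n) A)"
  proof (rule metric_CauchyI)
    fix e :: real
    assume e: "e > 0"
    then obtain N where N: "\<And>n z. n \<ge> N \<Longrightarrow> z \<in> spectrum A \<Longrightarrow> dist (poly (p n) z) (g z) < e / 4"
      using uniform_limitD[OF p, of "e / 4"] unfolding eventually_sequentially by auto
    have "dist (op_poly (p m) A) (op_poly (p n) A) < e" if "m \<ge> N" "n \<ge> N" for m n
    proof -
      have "cmod (poly (p m - p n) z) \<le> e / 2" if z: "z \<in> spectrum A" for z
        using dist_triangle2[of "poly (p m) z" "poly (p n) z" "g z"]
          N[OF \<open>m \<ge> N\<close> z] N[OF \<open>n \<ge> N\<close> z] by (simp add: dist_norm)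
      then have "norm (op_poly (p m - p n) A) \<le> e / 2"
        using norm_op_poly_le_iff[OF A, of "e / 2" "p m - p n"] e by auto
      then show ?thesis
        using A e by (simp add: op_poly_diff dist_norm selfadjoint_def)
    qed
    then show "\<exists>N. \<forall>m\<ge>N. \<forall>n\<ge>N. dist (op_poly (p m) A) (op_poly (p n) A) < e"
      by blast
  qed
  then show ?thesis
    by (rule Cauchy_convergent)
qed

lemma poly_limit_exists:
  fixes A :: "'a::chilbert_space \<Rightarrow>\<^sub>L 'a"
  assumes A: "selfadjoint A" and g: "continuous_on (spectrum A) g"
  shows "\<exists>T. poly_limit A g T"
proof -
  have "\<exists>p. \<forall>z\<in>spectrum A. cmod (poly p z - g z) < inverse (real (Suc n))" for n
    using poly_approximates_on_spectrum[OF A g, of "inverse (real (Suc n))"]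
    by (metis inverse_positive_iff_positive of_nat_0_less_iff zero_less_Suc)
  then obtain p where p: "\<And>n z. z \<in> spectrum A \<Longrightarrow> cmod (poly (p n) z - g z) < inverse (real (Suc n))"
    by metis
  have "uniform_limit (spectrum A) (\<lambda>n. poly (p n)) g sequentially"
  proof (rule uniform_limitI)
    fix e :: real
    assume "e > 0"
    then have "eventually (\<lambda>n. inverse (real (Suc n)) < e) sequentially"
      using order_tendstoD(2)[OF LIMSEQ_inverse_real_of_nat] by blast
    then show "eventually (\<lambda>n. \<forall>z\<in>spectrum A. dist (poly (p n) z) (g z) < e) sequentially"
    proof eventually_elim
      case (elim n)
      then show ?case
        using p[of _ n] unfolding dist_norm by fastforce
    qed
  qed
  then show ?thesis
    using uniform_limit_imp_op_poly_convergent[OF A]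
    unfolding poly_limit_def convergent_def by blast
qed

lemma poly_limit_bounded_ops:
  assumes "A \<in> bounded_ops" "poly_limit A g T"
  shows "T \<in> bounded_ops"
proof -
  obtain p where T: "(\<lambda>n. op_poly (p n) A) \<longlonglongrightarrow> T"
    using assms(2) unfolding poly_limit_def by blast
  have lim: "(\<lambda>n. op_poly (p n) A x) \<longlonglongrightarrow> T x" for x
    by (intro blinfun.tendsto T tendsto_const)
  have "T (c *\<^sub>C x) = c *\<^sub>C T x" for c x
  proof (rule LIMSEQ_unique[OF lim])
    show "(\<lambda>n. op_poly (p n) A (c *\<^sub>C x)) \<longlonglongrightarrow> c *\<^sub>C T x"
      unfolding blinfun_apply_bounded_ops[OF op_poly_bounded_ops[OF assms(1)]]
      by (rule bounded_linear.tendsto[OF bounded_linear_scaleC lim])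
  qed
  then show ?thesis
    by (simp add: bounded_ops_def)
qed

text \<open>The spectrum is real, so conjugating the coefficients of polynomials that converge to \<open>g\<close>
  gives polynomials that converge to the conjugate of \<open>g\<close>.\<close>

lemma poly_limit_adjoint:
  fixes A :: "'a::chilbert_space \<Rightarrow>\<^sub>L 'a"
  assumes A: "selfadjoint A" and g: "poly_limit A g T" and S: "poly_limit A (\<lambda>z. cnj (g z)) S"
  shows "is_adjoint S T"
proof -
  obtain p where p: "uniform_limit (spectrum A) (\<lambda>n. poly (p n)) g sequentially"
    and T: "(\<lambda>n. op_poly (p n) A) \<longlonglongrightarrow> T"
    using g unfolding poly_limit_def by blast
  let ?q = "\<lambda>n. map_poly cnj (p n)"
  have cnj: "poly (?q n) z = cnj (poly (p n) z)" if "z \<in> spectrum A" for n z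
  proof -
    have "cnj z = z"
      using spectrum_selfadjoint_real[OF A that] by (simp add: complex_eq_iff)
    then show ?thesis
      by (metis poly_cnj)
  qed
  have "uniform_limit (spectrum A) (\<lambda>n. poly (?q n)) (\<lambda>z. cnj (g z)) sequentially"
  proof (rule uniform_limitI)
    fix e :: real
    assume "e > 0"
    have "dist (poly (?q n) z) (cnj (g z)) = dist (poly (p n) z) (g z)" if "z \<in> spectrum A" for n z
      unfolding cnj[OF that] dist_norm by (metis complex_cnj_diff complex_mod_cnj)
    then show "eventually (\<lambda>n. \<forall>z\<in>spectrum A. dist (poly (?q n) z) (cnj (g z)) < e) sequentially"
      using uniform_limitD[OF p \<open>e > 0\<close>] by simp
  qed
  moreover from this obtain S' where S': "(\<lambda>n. op_poly (?q n) A) \<longlonglongrightarrow> S'"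
    using uniform_limit_imp_op_poly_convergent[OF A, of ?q] unfolding convergent_def by auto
  ultimately have "poly_limit A (\<lambda>z. cnj (g z)) S'"
    unfolding poly_limit_def by (intro exI[of _ ?q] conjI)
  then have "S' = S"
    using poly_limit_unique[OF A _ S] by blast
  have "inner (T x) y = inner x (S' y)" for x y
  proof (rule LIMSEQ_unique)
    show "(\<lambda>n. inner (op_poly (p n) A x) y) \<longlonglongrightarrow> inner (T x) y"
      by (intro tendsto_inner blinfun.tendsto T tendsto_const)
    show "(\<lambda>n. inner (op_poly (p n) A x) y) \<longlonglongrightarrow> inner x (S' y)"
      unfolding is_adjointD[OF op_poly_adjoint[OF A]]
      by (intro tendsto_inner blinfun.tendsto S' tendsto_const)
  qed
  then show ?thesis
    using is_adjoint_iff_inner poly_limit_bounded_ops[OF _ S] A \<open>S' = S\<close>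
    by (auto simp: selfadjoint_def)
qed

lemma continuous_calculus_exists:
  fixes A :: "'a::chilbert_space \<Rightarrow>\<^sub>L 'a"
  assumes A: "selfadjoint A"
  shows "is_continuous_calculus A (\<lambda>g. SOME T. poly_limit A g T)" (is "is_continuous_calculus A ?\<Phi>")
proof -
  have lim: "poly_limit A g (?\<Phi> g)" if "continuous_on (spectrum A) g" for g
    using poly_limit_exists[OF A that] by (rule someI_ex)
  have eq: "?\<Phi> g = T" if "poly_limit A g T" for g T
    using poly_limit_unique[OF A _ that] that by (metis someI)
  have Ab: "A \<in> bounded_ops"
    using A by (simp add: selfadjoint_def)
  have "?\<Phi> (\<lambda>z. 1) = id_blinfun"
    using eq[OF poly_limit_poly[of A "[:1:]", unfolded poly_eq_fun]] by simp
  moreover have "?\<Phi> (\<lambda>z. z) = A"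
    using eq[OF poly_limit_poly[of A "[:0, 1:]", unfolded poly_eq_fun]] by (simp only: op_poly_X)
  moreover have "is_adjoint (?\<Phi> (\<lambda>z. cnj (g z))) (?\<Phi> g)" if "continuous_on (spectrum A) g" for g
    by (rule poly_limit_adjoint[OF A lim[OF that] lim[OF continuous_on_cnj[OF that]]])
  moreover have "?\<Phi> g \<in> bounded_ops" if "continuous_on (spectrum A) g" for g
    using poly_limit_bounded_ops[OF Ab lim[OF that]] .
  moreover have "\<forall>M\<ge>0. norm (?\<Phi> g) \<le> M \<longleftrightarrow> (\<forall>z\<in>spectrum A. cmod (g z) \<le> M)"
    if "continuous_on (spectrum A) g" for g
    using norm_poly_limit_le_iff[OF A lim[OF that]] by blast
  moreover have "?\<Phi> (\<lambda>z. a * g z + b * h z) = scaleC_op a (?\<Phi> g) + scaleC_op b (?\<Phi> h)"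
    if "continuous_on (spectrum A) g" "continuous_on (spectrum A) h" for g h a b
    by (intro eq poly_limit_lincomb A lim that)
  moreover have "?\<Phi> (\<lambda>z. g z * h z) = ?\<Phi> g o\<^sub>L ?\<Phi> h"
    if "continuous_on (spectrum A) g" "continuous_on (spectrum A) h" for g h
    by (intro eq poly_limit_mult A lim that)
  ultimately show ?thesis
    unfolding is_continuous_calculus_def by blast
qed

text \<open>Any calculus sends polynomials in the identity function to polynomials of \<open>A\<close>, and it is
  isometric, so it is determined by uniform approximation.\<close>

lemma continuous_calculus_unique:
  fixes A :: "'a::chilbert_space \<Rightarrow>\<^sub>L 'a"
  assumes A: "selfadjoint A" and \<Phi>: "is_continuous_calculus A \<Phi>"
    and g: "continuous_on (spectrum A) g"
  shows "poly_limit A g (\<Phi> g)"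
proof -
  have lin: "\<Phi> (\<lambda>z. a * g z + b * h z) = scaleC_op a (\<Phi> g) + scaleC_op b (\<Phi> h)"
    and mult: "\<Phi> (\<lambda>z. g z * h z) = \<Phi> g o\<^sub>L \<Phi> h"
    if "continuous_on (spectrum A) g" "continuous_on (spectrum A) h" for g h a b
    using \<Phi> that unfolding is_continuous_calculus_def by blast+
  have norm: "norm (\<Phi> g) \<le> M \<longleftrightarrow> (\<forall>z\<in>spectrum A. cmod (g z) \<le> M)"
    if "continuous_on (spectrum A) g" "M \<ge> 0" for g M
    using \<Phi> that unfolding is_continuous_calculus_def by blast
  have cont: "continuous_on (spectrum A) (poly p)" for p
    using continuous_on_poly[OF continuous_on_id] by simp
  have 1: "\<Phi> (\<lambda>z. 1) = id_blinfun" and X: "\<Phi> (\<lambda>z. z) = A"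
    using \<Phi> unfolding is_continuous_calculus_def by blast+
  have poly: "\<Phi> (poly p) = op_poly p A" for p
  proof (induction p)
    case 0
    show ?case
      using lin[of "\<lambda>z. 1" "\<lambda>z. 1" 0 0] by simp
  next
    case (pCons a p)
    have "\<Phi> (poly (pCons a p)) = \<Phi> (\<lambda>z. a * 1 + 1 * (z * poly p z))"
      by (rule arg_cong[of _ _ \<Phi>]) auto
    also have "\<dots> = scaleC_op a (\<Phi> (\<lambda>z. 1)) + scaleC_op 1 (\<Phi> (\<lambda>z. z * poly p z))"
      by (rule lin) (auto intro!: continuous_intros cont)
    also have "\<Phi> (\<lambda>z. z * poly p z) = A o\<^sub>L op_poly p A"
      unfolding mult[OF continuous_on_id cont] X pCons.IH ..
    finally show ?case
      by (simp add: 1)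
  qed
  obtain T where T: "poly_limit A g T"
    using poly_limit_exists[OF A g] by blast
  then obtain p where p: "uniform_limit (spectrum A) (\<lambda>n. poly (p n)) g sequentially"
    and pT: "(\<lambda>n. op_poly (p n) A) \<longlonglongrightarrow> T"
    unfolding poly_limit_def by blast
  have "(\<lambda>n. op_poly (p n) A) \<longlonglongrightarrow> \<Phi> g"
  proof (rule tendstoI)
    fix e :: real
    assume e: "e > 0"
    then have "eventually (\<lambda>n. \<forall>z\<in>spectrum A. dist (poly (p n) z) (g z) < e / 2) sequentially"
      using uniform_limitD[OF p, of "e / 2"] by simp
    then show "eventually (\<lambda>n. dist (op_poly (p n) A) (\<Phi> g) < e) sequentially"
    proof eventually_elim
      case (elim n)
      have "\<Phi> (\<lambda>z. 1 * poly (p n) z + (- 1) * g z) = op_poly (p n) A - \<Phi> g"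
        using lin[of "poly (p n)" g 1 "- 1"] g by (simp add: poly continuous_intros)
      moreover have "norm (\<Phi> (\<lambda>z. 1 * poly (p n) z + (- 1) * g z)) \<le> e / 2"
        using elim e g by (subst norm) (auto simp: dist_norm less_imp_le intro!: continuous_intros)
      ultimately show ?case
        using e by (simp add: dist_norm)
    qed
  qed
  then show ?thesis
    using T LIMSEQ_unique[OF pT] by blast
qed

text \<open>All calculi agree on continuous functions and one exists, so the definite description in \<open>cfc\<close>
  denotes their common value.\<close>

lemma poly_limit_cfc:
  fixes A :: "'a::chilbert_space \<Rightarrow>\<^sub>L 'a"
  assumes A: "selfadjoint A" and f: "continuous_on (spectrum A) (\<lambda>z. complex_of_real (f (Re z)))"
  shows "poly_limit A (\<lambda>z. complex_of_real (f (Re z))) (cfc f A)"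
proof -
  let ?g = "\<lambda>z. complex_of_real (f (Re z))"
  obtain T where T: "poly_limit A ?g T"
    using poly_limit_exists[OF A f] by blast
  have "\<Phi> ?g = T" if "is_continuous_calculus A \<Phi>" for \<Phi>
    using continuous_calculus_unique[OF A that f] T poly_limit_unique[OF A] by blast
  then have "cfc f A = T"
    unfolding cfc_def using continuous_calculus_exists[OF A] by (intro the_equality) blast+
  then show ?thesis
    using T by simp
qed

section \<open>Segments of selfadjoint operators\<close>

lemma selfadjoint_lincomb:
  assumes "selfadjoint A" "selfadjoint B"
  shows "selfadjoint (a *\<^sub>R A + b *\<^sub>R B)"
  using assms
  by (auto simp: selfadjoint_iff_inner bounded_ops_def blinfun.add_left blinfun.scaleR_left
      inner_add_left inner_add_right complex_vector.scale_right_distrib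
      linear_scale[OF bounded_linear.linear[OF bounded_linear_scaleC]])

text \<open>Membership of the spectrum in a disc is a norm bound, hence a convex condition.\<close>

lemma spectrum_subset_cball_iff:
  fixes A :: "'a::chilbert_space \<Rightarrow>\<^sub>L 'a"
  assumes "selfadjoint A" "r \<ge> 0"
  shows "spectrum A \<subseteq> cball c r \<longleftrightarrow> norm (shift A c) \<le> r"
  using norm_op_poly_le_iff[OF assms, of "[:- c, 1:]"]
  by (auto simp: op_poly_linear_factor dist_norm norm_minus_commute simp del: op_poly_pCons)

lemma spectrum_convex_combination_subset_cball:
  fixes A B :: "'a::chilbert_space \<Rightarrow>\<^sub>L 'a"
  assumes "selfadjoint A" "selfadjoint B" "r \<ge> 0" "t \<in> {0..1}"
    and "spectrum A \<subseteq> cball c r" "spectrum B \<subseteq> cball c r"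
  shows "spectrum ((1 - t) *\<^sub>R A + t *\<^sub>R B) \<subseteq> cball c r"
proof -
  have "norm (shift A c) \<le> r" "norm (shift B c) \<le> r"
    using assms spectrum_subset_cball_iff by blast+
  moreover have "shift ((1 - t) *\<^sub>R A + t *\<^sub>R B) c = (1 - t) *\<^sub>R shift A c + t *\<^sub>R shift B c"
    by (simp add: algebra_simps)
  moreover have "norm ((1 - t) *\<^sub>R shift A c + t *\<^sub>R shift B c)
      \<le> (1 - t) * norm (shift A c) + t * norm (shift B c)"
    using assms(4) norm_triangle_ineq[of "(1 - t) *\<^sub>R shift A c" "t *\<^sub>R shift B c"] by simp
  ultimately have "norm (shift ((1 - t) *\<^sub>R A + t *\<^sub>R B) c) \<le> r"
    using assms(4) convex_bound_le[of "norm (shift A c)" r "norm (shift B c)" "1 - t" t] by auto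
  then show ?thesis
    using assms by (simp add: spectrum_subset_cball_iff selfadjoint_lincomb)
qed

text \<open>If \<open>[a, b]\<close> is the smallest interval containing both spectra, the disc with diameter \<open>[a, b]\<close>
  contains the spectra of all operators on the segment, and its real points lie in \<open>I\<close>.\<close>

lemma spectrum_segment_subset_compact:
  fixes A B :: "'a::chilbert_space \<Rightarrow>\<^sub>L 'a"
  assumes A: "selfadjoint A" and B: "selfadjoint B" and I: "is_interval I"
    and sub: "spectrum A \<subseteq> complex_of_real ` I" "spectrum B \<subseteq> complex_of_real ` I"
  obtains X where "compact X" "X \<subseteq> I"
    "\<And>t. t \<in> {0..1} \<Longrightarrow> spectrum ((1 - t) *\<^sub>R A + t *\<^sub>R B) \<subseteq> complex_of_real ` X"
proof (cases "spectrum A = {}")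
  \<comment> \<open>This is the trivial space, where \<open>I\<close> may be empty.\<close>
  case True
  then have "x = 0" for x :: 'a
    using spectrum_nonempty[OF A] by blast
  then have "bounded_below T" for T :: "'a \<Rightarrow>\<^sub>L 'a"
    unfolding bounded_below_def by (intro exI[of _ 1]) (simp, metis norm_zero norm_ge_zero)
  then have "spectrum ((1 - t) *\<^sub>R A + t *\<^sub>R B) = {}" for t
    using spectrum_selfadjoint_iff[OF selfadjoint_lincomb[OF A B]] by blast
  then show ?thesis
    using that[of "{}"] by simp
next
  case False
  define Y where "Y = Re ` (spectrum A \<union> spectrum B)"
  have Y: "compact Y" "Y \<noteq> {}" "Y \<subseteq> I"
    using False sub
    by (auto simp: Y_def intro!: compact_continuous_image compact_Un compact_spectrum A B continuous_intros)
  obtain a b where a: "a \<in> Y" "\<And>y. y \<in> Y \<Longrightarrow> a \<le> y" and b: "b \<in> Y" "\<And>y. y \<in> Y \<Longrightarrow> y \<le> b"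
    using compact_attains_inf[OF Y(1,2)] compact_attains_sup[OF Y(1,2)] by blast
  have ab: "a \<le> b" "{a..b} \<subseteq> I"
    using a b Y(3) I by (auto intro: mem_is_interval_1_I)
  let ?c = "complex_of_real ((a + b) / 2)" and ?r = "(b - a) / 2"
  have cball: "complex_of_real x \<in> cball ?c ?r \<longleftrightarrow> x \<in> {a..b}" for x
    by (simp only: mem_cball dist_of_real) (auto simp: dist_real_def abs_le_iff field_simps)
  have "spectrum A \<subseteq> cball ?c ?r" "spectrum B \<subseteq> cball ?c ?r"
  proof -
    have "z \<in> cball ?c ?r" if "z \<in> complex_of_real ` I" "Re z \<in> Y" for z
      using that a(2) b(2) cball by auto
    then show "spectrum A \<subseteq> cball ?c ?r" "spectrum B \<subseteq> cball ?c ?r"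
      using sub unfolding Y_def by blast+
  qed
  then have in_cball: "spectrum ((1 - t) *\<^sub>R A + t *\<^sub>R B) \<subseteq> cball ?c ?r" if "t \<in> {0..1}" for t
    using that ab by (intro spectrum_convex_combination_subset_cball A B) auto
  show ?thesis
  proof (rule that[of "{a..b}"])
    fix t :: real
    assume t: "t \<in> {0..1}"
    show "spectrum ((1 - t) *\<^sub>R A + t *\<^sub>R B) \<subseteq> complex_of_real ` {a..b}"
    proof
      fix z
      assume z: "z \<in> spectrum ((1 - t) *\<^sub>R A + t *\<^sub>R B)"
      then have "z = complex_of_real (Re z)"
        using spectrum_selfadjoint_real[OF selfadjoint_lincomb[OF A B] z] by (simp add: complex_eq_iff)
      then show "z \<in> complex_of_real ` {a..b}"
        using in_cball[OF t] z cball[of "Re z"] by auto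
    qed
  qed (use ab in auto)
qed

section \<open>Continuous dependence of f(A) on A\<close>

lemma continuous_on_spectrum:
  assumes "continuous_on X f" "spectrum A \<subseteq> complex_of_real ` X"
  shows "continuous_on (spectrum A) (\<lambda>z. complex_of_real (f (Re z)))"
proof -
  have "Re ` spectrum A \<subseteq> X"
    using assms(2) by auto
  then show ?thesis
    by (intro continuous_intros continuous_on_compose2[OF assms(1)]) auto
qed

lemma selfadjoint_cfc:
  fixes A :: "'a::chilbert_space \<Rightarrow>\<^sub>L 'a"
  assumes A: "selfadjoint A" and f: "continuous_on X f" "spectrum A \<subseteq> complex_of_real ` X"
  shows "selfadjoint (cfc f A)"
proof -
  note lim = poly_limit_cfc[where f = f, OF A continuous_on_spectrum[OF f]]
  then show ?thesis
    using A poly_limit_bounded_ops[OF _ lim] poly_limit_adjoint[OF A lim, of "cfc f A"]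
    by (simp add: selfadjoint_def)
qed

lemma norm_op_poly_minus_cfc_le:
  fixes A :: "'a::chilbert_space \<Rightarrow>\<^sub>L 'a"
  assumes A: "selfadjoint A" and f: "continuous_on X f" "spectrum A \<subseteq> complex_of_real ` X"
    and p: "\<And>x. x \<in> X \<Longrightarrow> cmod (poly p (complex_of_real x) - complex_of_real (f x)) \<le> e"
    and "e \<ge> 0"
  shows "norm (op_poly p A - cfc f A) \<le> e"
proof -
  have "poly_limit A (\<lambda>z. 1 * poly p z + (- 1) * complex_of_real (f (Re z)))
      (scaleC_op 1 (op_poly p A) + scaleC_op (- 1) (cfc f A))"
    by (intro poly_limit_lincomb A poly_limit_poly poly_limit_cfc continuous_on_spectrum[OF f])
  then have "norm (scaleC_op 1 (op_poly p A) + scaleC_op (- 1) (cfc f A)) \<le> e \<longleftrightarrow>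
      (\<forall>z\<in>spectrum A. cmod (1 * poly p z + (- 1) * complex_of_real (f (Re z))) \<le> e)"
    by (rule norm_poly_limit_le_iff[OF A _ \<open>e \<ge> 0\<close>])
  moreover have "cmod (1 * poly p z + (- 1) * complex_of_real (f (Re z))) \<le> e"
    if "z \<in> spectrum A" for z
    using p f(2) that by auto
  ultimately show ?thesis by simp
qed

lemma continuous_on_op_poly:
  assumes "continuous_on S T"
  shows "continuous_on S (\<lambda>t. op_poly p (T t))"
proof (induction p)
  case (pCons a p)
  then show ?case
    by (auto intro!: continuous_intros assms
        bounded_bilinear.continuous_on[OF bounded_bilinear_blinfun_compose])
qed simp

text \<open>Functional calculus is norm continuous on operators with spectra in a common compact set:
  it is a uniform limit of polynomial functions there.\<close>

lemma continuous_on_cfc: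
  fixes T :: "'b::topological_space \<Rightarrow> ('a::chilbert_space \<Rightarrow>\<^sub>L 'a)"
  assumes T: "continuous_on S T" "\<And>t. t \<in> S \<Longrightarrow> selfadjoint (T t)"
    and X: "compact X" "continuous_on X f" "\<And>t. t \<in> S \<Longrightarrow> spectrum (T t) \<subseteq> complex_of_real ` X"
  shows "continuous_on S (\<lambda>t. cfc f (T t))"
proof -
  have "\<exists>p. \<forall>x\<in>X. cmod (poly p (complex_of_real x) - complex_of_real (f x)) < inverse (real (Suc n))"
    for n
    using complex_poly_approximates_on_reals[OF X(1,2), of "inverse (real (Suc n))"]
    by (metis inverse_positive_iff_positive of_nat_0_less_iff zero_less_Suc)
  then obtain p where p:
    "\<And>n x. x \<in> X \<Longrightarrow> cmod (poly (p n) (complex_of_real x) - complex_of_real (f x)) < inverse (real (Suc n))"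
    by metis
  have "uniform_limit S (\<lambda>n t. op_poly (p n) (T t)) (\<lambda>t. cfc f (T t)) sequentially"
  proof (rule uniform_limitI)
    fix e :: real
    assume "e > 0"
    then have "eventually (\<lambda>n. inverse (real (Suc n)) < e) sequentially"
      using order_tendstoD(2)[OF LIMSEQ_inverse_real_of_nat] by blast
    then show "eventually (\<lambda>n. \<forall>t\<in>S. dist (op_poly (p n) (T t)) (cfc f (T t)) < e) sequentially"
    proof eventually_elim
      case (elim n)
      show ?case
      proof
        fix t
        assume "t \<in> S"
        then have "norm (op_poly (p n) (T t) - cfc f (T t)) \<le> inverse (real (Suc n))"
          using p[of _ n] by (intro norm_op_poly_minus_cfc_le[of _ X] T X) (auto intro: less_imp_le)
        then show "dist (op_poly (p n) (T t)) (cfc f (T t)) < e"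
          using elim by (simp add: dist_norm)
      qed
    qed
  qed
  then show ?thesis
    by (rule uniform_limit_theorem[rotated]) (simp_all add: continuous_on_op_poly T)
qed

section \<open>Integration of operator inequalities\<close>

lemma op_le_iff_inner:
  "A \<le>\<^sub>o\<^sub>p B \<longleftrightarrow> selfadjoint A \<and> selfadjoint B \<and> (\<forall>x. inner (A x) x \<le> inner (B x) x)"
  by (simp add: op_le_def inner_eq_Re_cinner)

lemma has_integral_blinfun_apply:
  fixes F :: "real \<Rightarrow> ('a::real_normed_vector \<Rightarrow>\<^sub>L 'b::real_normed_vector)"
  assumes "(F has_integral J) S"
  shows "((\<lambda>t. F t x) has_integral J x) S"
  using has_integral_linear[OF assms blinfun.bounded_linear_left[of x]] by (simp add: o_def)

lemma has_integral_blinfun_inner: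
  fixes F :: "real \<Rightarrow> ('a::real_normed_vector \<Rightarrow>\<^sub>L 'b::real_inner)"
  assumes "(F has_integral J) S"
  shows "((\<lambda>t. inner (F t x) y) has_integral inner (J x) y) S"
  using has_integral_linear[OF has_integral_blinfun_apply[OF assms] bounded_linear_inner_left[of y]]
  by (simp add: o_def)

text \<open>Selfadjointness is expressed by linear equations between values of \<open>F t\<close>, which integrate.\<close>

lemma selfadjoint_has_integral:
  fixes F :: "real \<Rightarrow> ('a::complex_inner \<Rightarrow>\<^sub>L 'a)"
  assumes J: "(F has_integral J) S" and F: "\<And>t. t \<in> S \<Longrightarrow> selfadjoint (F t)"
  shows "selfadjoint J"
proof -
  have "J (c *\<^sub>C x) = c *\<^sub>C J x" for c x
  proof (rule has_integral_unique)
    show "((\<lambda>t. F t (c *\<^sub>C x)) has_integral J (c *\<^sub>C x)) S"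
      by (rule has_integral_blinfun_apply[OF J])
    show "((\<lambda>t. F t (c *\<^sub>C x)) has_integral c *\<^sub>C J x) S"
      by (rule has_integral_eq[OF _ has_integral_linear[OF has_integral_blinfun_apply[OF J, of x]
              bounded_linear_scaleC[of c]]])
        (use F in \<open>auto simp: selfadjoint_def bounded_ops_def\<close>)
  qed
  moreover have "inner (J x) y = inner x (J y)" for x y
  proof (rule has_integral_unique)
    show "((\<lambda>t. inner (F t x) y) has_integral inner (J x) y) S"
      by (rule has_integral_blinfun_inner[OF J])
    have "((\<lambda>t. inner (F t y) x) has_integral inner x (J y)) S"
      using has_integral_blinfun_inner[OF J, of y x] by (simp add: inner_commute)
    then show "((\<lambda>t. inner (F t x) y) has_integral inner x (J y)) S"
      by (rule has_integral_eq[rotated]) (metis F selfadjoint_iff_inner inner_commute)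
  qed
  ultimately show ?thesis
    by (simp add: selfadjoint_iff_inner bounded_ops_def)
qed

lemma has_integral_reflect_unit:
  fixes g :: "real \<Rightarrow> 'a::real_normed_vector"
  assumes "(g has_integral i) {0..1}"
  shows "((\<lambda>t. g (1 - t)) has_integral i) {0..1}"
  using has_integral_affinity[of g i 0 1 "- 1" 1] assms
  by (simp add: image_affinity_atLeastAtMost)

lemma has_integral_powr_unit:
  fixes s :: real
  assumes "s > 0"
  shows "((\<lambda>t. t powr s) has_integral 1 / (s + 1)) {0..1}"
  using has_integral_powr_from_0[of s 1] assms by simp

text \<open>The next two lemmas are the Hermite-Hadamard inequalities for a scalar function \<open>g\<close>.  They assume
  only the two instances of \<open>s\<close>-convexity that hold for the quadratic forms \<open>g(t) = \<langle>f(T(t)) x, x\<rangle>\<close>: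
  comparison with the endpoints here, and comparison of \<open>m = g(1/2)\<close> with points symmetric about
  \<open>1/2\<close> in the second lemma.\<close>

lemma hermite_hadamard_upper:
  fixes g :: "real \<Rightarrow> real"
  assumes "(g has_integral i) {0..1}" and "s > 0"
    and "\<And>t. t \<in> {0..1} \<Longrightarrow> g t \<le> (1 - t) powr s * g 0 + t powr s * g 1"
  shows "i \<le> (1 / (s + 1)) * (g 0 + g 1)"
proof -
  have "((\<lambda>t. (1 - t) powr s * g 0 + t powr s * g 1) has_integral
      1 / (s + 1) * g 0 + 1 / (s + 1) * g 1) {0..1}"
    using \<open>s > 0\<close>
    by (intro has_integral_add has_integral_mult_left has_integral_powr_unit
        has_integral_reflect_unit[OF has_integral_powr_unit])
  from has_integral_le[OF assms(1) this assms(3)] show ?thesis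
    by (simp add: distrib_left)
qed

lemma hermite_hadamard_lower:
  fixes g :: "real \<Rightarrow> real"
  assumes g: "(g has_integral i) {0..1}"
    and "\<And>t. t \<in> {0..1} \<Longrightarrow> m \<le> (1 / 2) powr s * (g t + g (1 - t))"
  shows "2 powr (s - 1) * m \<le> i"
proof -
  have sym: "((\<lambda>t. (1 / 2) powr s * (g t + g (1 - t))) has_integral (1 / 2) powr s * (i + i)) {0..1}"
    by (intro has_integral_mult_right has_integral_add g has_integral_reflect_unit)
  have const: "((\<lambda>t::real. m) has_integral m) {0..1}"
    using has_integral_const_real[of m 0 1] by simp
  have "m \<le> (1 / 2) powr s * (i + i)"
    by (rule has_integral_le[OF const sym assms(2)])
  then have "2 powr (s - 1) * m \<le> 2 powr (s - 1) * ((1 / 2) powr s * (i + i))"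
    by (intro mult_left_mono) auto
  also have "\<dots> = i"
    by (simp add: powr_diff powr_divide)
  finally show ?thesis .
qed

theorem theorem6:
  fixes I :: "real set" and K :: "('h::chilbert_space \<Rightarrow>\<^sub>L 'h) set"
    and s :: real and f :: "real \<Rightarrow> real" and A B :: "'h \<Rightarrow>\<^sub>L 'h"
  assumes "is_interval I" and "I \<subseteq> {0..}"
    and "K \<subseteq> positive_ops" and "convex K"
    and "0 < s" and "s \<le> 1"
    and "operator_s_convex s I K f"
    and "A \<in> K" and "B \<in> K"
    and "spectrum A \<subseteq> complex_of_real ` I" and "spectrum B \<subseteq> complex_of_real ` I"
  shows "(\<lambda>t. cfc f ((1 - t) *\<^sub>R A + t *\<^sub>R B)) integrable_on {0..1} \<and>
    2 powr (s - 1) *\<^sub>R cfc f ((1 / 2) *\<^sub>R (A + B))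
      \<le>\<^sub>o\<^sub>p integral {0..1} (\<lambda>t. cfc f ((1 - t) *\<^sub>R A + t *\<^sub>R B)) \<and>
    integral {0..1} (\<lambda>t. cfc f ((1 - t) *\<^sub>R A + t *\<^sub>R B))
      \<le>\<^sub>o\<^sub>p (1 / (s + 1)) *\<^sub>R (cfc f A + cfc f B)"
proof -
  define T where "T t = (1 - t) *\<^sub>R A + t *\<^sub>R B" for t
  define F where "F t = cfc f (T t)" for t
  define J where "J = integral {0..1} F"
  have A: "selfadjoint A" and B: "selfadjoint B"
    using assms(3,8,9) by (auto simp: positive_ops_def op_le_def)
  have sT: "selfadjoint (T t)" for t
    unfolding T_def by (rule selfadjoint_lincomb[OF A B])
  have f: "continuous_on I f"
    and sconv: "\<And>u A B. \<lbrakk>u \<in> {0..1}; A \<in> K; B \<in> K; spectrum A \<subseteq> complex_of_real ` I;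
      spectrum B \<subseteq> complex_of_real ` I\<rbrakk> \<Longrightarrow>
      cfc f ((1 - u) *\<^sub>R A + u *\<^sub>R B) \<le>\<^sub>o\<^sub>p (1 - u) powr s *\<^sub>R cfc f A + u powr s *\<^sub>R cfc f B"
    using assms(7) unfolding operator_s_convex_def by blast+
  obtain X where X: "compact X" "X \<subseteq> I" "\<And>t. t \<in> {0..1} \<Longrightarrow> spectrum (T t) \<subseteq> complex_of_real ` X"
    using spectrum_segment_subset_compact[OF A B assms(1,10,11)] unfolding T_def by metis
  have TK: "T t \<in> K" if "t \<in> {0..1}" for t
    using that convexD_alt[OF assms(4,8,9), of t] by (simp add: T_def)
  have TI: "spectrum (T t) \<subseteq> complex_of_real ` I" if "t \<in> {0..1}" for t
    using X(3)[OF that] image_mono[OF X(2)] by (rule order_trans)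
  have sF: "selfadjoint (F t)" if "t \<in> {0..1}" for t
    unfolding F_def using sT f TI[OF that] by (rule selfadjoint_cfc)
  have "continuous_on {0..1} F"
    unfolding F_def
  proof (rule continuous_on_cfc[OF _ sT X(1) continuous_on_subset[OF f X(2)] X(3)])
    show "continuous_on {0..1} T"
      unfolding T_def by (intro continuous_intros)
  qed
  then have int: "F integrable_on {0..1}"
    by (rule integrable_continuous_interval)
  then have J: "(F has_integral J) {0..1}"
    unfolding J_def by (rule integrable_integral)
  have sJ: "selfadjoint J"
    using J sF by (rule selfadjoint_has_integral)
  have F01: "F 0 = cfc f A" "F 1 = cfc f B" and mid: "T (1 / 2) = (1 / 2) *\<^sub>R (A + B)"
    by (simp_all add: F_def T_def scaleR_add_right)
  have F_half: "F (1 / 2) = cfc f ((1 / 2) *\<^sub>R (A + B))"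
    by (simp only: F_def mid)
  have "2 powr (s - 1) *\<^sub>R F (1 / 2) \<le>\<^sub>o\<^sub>p J"
    unfolding op_le_iff_inner
  proof (intro conjI allI)
    show "selfadjoint (2 powr (s - 1) *\<^sub>R F (1 / 2))"
      using selfadjoint_lincomb[OF sF sF, of "1/2" "1/2" "2 powr (s - 1)" 0] by simp
    fix x
    have "inner (F (1 / 2) x) x \<le> (1 / 2) powr s * (inner (F t x) x + inner (F (1 - t) x) x)"
      if t: "t \<in> {0..1}" for t
    proof -
      have t': "1 - t \<in> {0..1}"
        using t by simp
      have "(1 - 1 / 2) *\<^sub>R T t + (1 / 2) *\<^sub>R T (1 - t) = T (1 / 2)"
        by (simp add: T_def algebra_simps flip: scaleR_add_left)
      then have "F (1 / 2) \<le>\<^sub>o\<^sub>p (1 / 2) powr s *\<^sub>R F t + (1 / 2) powr s *\<^sub>R F (1 - t)"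
        using sconv[of "1 / 2", OF _ TK[OF t] TK[OF t'] TI[OF t] TI[OF t']] by (simp add: F_def)
      then show ?thesis
        by (simp add: op_le_iff_inner blinfun.add_left blinfun.scaleR_left inner_add_left distrib_left)
    qed
    from hermite_hadamard_lower[OF has_integral_blinfun_inner[OF J] this]
    show "inner ((2 powr (s - 1) *\<^sub>R F (1 / 2)) x) x \<le> inner (J x) x"
      by (simp add: blinfun.scaleR_left)
  qed (rule sJ)
  moreover have "J \<le>\<^sub>o\<^sub>p (1 / (s + 1)) *\<^sub>R (F 0 + F 1)"
    unfolding op_le_iff_inner
  proof (intro conjI allI)
    show "selfadjoint ((1 / (s + 1)) *\<^sub>R (F 0 + F 1))"
      unfolding scaleR_add_right by (intro selfadjoint_lincomb sF) auto
    fix x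
    have "inner (F t x) x \<le> (1 - t) powr s * inner (F 0 x) x + t powr s * inner (F 1 x) x"
      if t: "t \<in> {0..1}" for t
    proof -
      have "F t \<le>\<^sub>o\<^sub>p (1 - t) powr s *\<^sub>R F 0 + t powr s *\<^sub>R F 1"
        using sconv[OF t assms(8-11)] unfolding F01 by (simp only: F_def T_def)
      then show ?thesis
        by (simp add: op_le_iff_inner blinfun.add_left blinfun.scaleR_left inner_add_left)
    qed
    from hermite_hadamard_upper[OF has_integral_blinfun_inner[OF J] assms(5) this]
    show "inner (J x) x \<le> inner (((1 / (s + 1)) *\<^sub>R (F 0 + F 1)) x) x"
      by (simp add: blinfun.scaleR_left blinfun.add_left inner_add_left)
  qed (rule sJ)
  ultimately show ?thesis
    using int unfolding F_half F01 J_def unfolding F_def T_def by blast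
qed

end
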